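(* Let $3\le g\le n$, and let $\tilde{U}=C_{g}(v)\circ S_{n-g+1}(v)$, where $v$ is the center of the star $S_{n-g+1}$ (and a vertex of $C_g$). Then for any unicyclic graph $U$ of order $n$ with girth $g$, $\rho(U^{2})\leq \rho(\tilde{U}^{2})$, with equality if and only if $U$ is (isomorphic to) $\tilde{U}$.
   Context: All graphs are simple, undirected and finite. A unicyclic graph is a connected graph containing exactly one cycle; its girth is the length of that cycle. $C_g$ is the cycle on $g$ vertices and $S_m$ the star on $m$ vertices. $\rho(G)$ is the spectral radius of the adjacency matrix of $G$. The square $G^2$ of a connected graph $G$ is obtained from $G$ by adding an edge between every pair of vertices at distance $2$ in $G$. $G_1(v)\circ G_2(v)$ denotes the coalescence of vertex-disjoint connected graphs $G_1,G_2$ obtained by identifying a vertex of $G_1$ with a vertex of $G_2$ into a single vertex $v$. *)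

theory Defs
  imports "Graph_Theory.Graph_Theory" "Jordan_Normal_Form.Spectral_Radius"
begin

text \<open>
  A finite simple undirected graph is a \<^locale>\<open>pair_graph\<close>: a finite loop-free digraph without
  parallel arcs whose arc relation is symmetric. The edge \<open>{u, v}\<close> is the pair of arcs
  \<open>(u, v)\<close>, \<open>(v, u)\<close>.
\<close>

text \<open>
  In a symmetric digraph the closed walk \<open>u, v, u\<close> is a \<^const>\<open>pre_digraph.cycle\<close>; requiring length
  at least 3 leaves the cycles of the undirected graph. The same cycle is traversed by several
  walks (different starting points, two orientations), hence cycles are identified with their
  sets of undirected edges.
\<close>

definition cycle_edge_sets :: "'a pair_pre_digraph \<Rightarrow> 'a set set set" where
  "cycle_edge_sets G =
     {(\<lambda>(u, v). {u, v}) ` set p | p. pre_digraph.cycle (with_proj G) p \<and> 3 \<le> length p}"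

definition unicyclic :: "'a pair_pre_digraph \<Rightarrow> bool" where
  "unicyclic G \<longleftrightarrow>
     pair_graph G \<and> Digraph_Component.connected (with_proj G) \<and> (\<exists>!C. C \<in> cycle_edge_sets G)"

text \<open>Only meaningful for unicyclic graphs: the length of the unique cycle.\<close>

definition unicyclic_girth :: "'a pair_pre_digraph \<Rightarrow> nat" where
  "unicyclic_girth G = card (THE C. C \<in> cycle_edge_sets G)"

definition cycle_graph :: "nat \<Rightarrow> nat pair_pre_digraph" where
  "cycle_graph g =
     \<lparr> pverts = {..<g},
       parcs = {(i, j). i < g \<and> j < g \<and> (j = Suc i mod g \<or> i = Suc j mod g)} \<rparr>"

text \<open>The star on \<open>m\<close> vertices, with centre \<open>0\<close>.\<close>

definition star_graph :: "nat \<Rightarrow> nat pair_pre_digraph" where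
  "star_graph m =
     \<lparr> pverts = {..<m},
       parcs = {(i, j). i < m \<and> j < m \<and> i \<noteq> j \<and> (i = 0 \<or> j = 0)} \<rparr>"

text \<open>
  The coalescence of \<open>G\<close> and \<open>H\<close> at \<open>u\<close> and \<open>w\<close>. The sum type makes the two graphs disjoint;
  the merged vertex is \<open>Inl u\<close>.
\<close>

definition coalescence ::
  "'a pair_pre_digraph \<Rightarrow> 'a \<Rightarrow> 'b pair_pre_digraph \<Rightarrow> 'b \<Rightarrow> ('a + 'b) pair_pre_digraph" where
  "coalescence G u H w =
     (let h = (\<lambda>x. if x = w then Inl u else Inr x) in
       \<lparr> pverts = Inl ` pverts G \<union> h ` pverts H,
         parcs = map_prod Inl Inl ` parcs G \<union> map_prod h h ` parcs H \<rparr>)"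

text \<open>The weight function \<open>\<lambda>_. 1\<close> makes \<^const>\<open>wf_digraph.\<mu>\<close> the usual graph distance.\<close>

definition graph_square :: "'a pair_pre_digraph \<Rightarrow> 'a pair_pre_digraph" where
  "graph_square G =
     \<lparr> pverts = pverts G,
       parcs = parcs G \<union>
         {(u, v). u \<in> pverts G \<and> v \<in> pverts G \<and> wf_digraph.\<mu> (with_proj G) (\<lambda>_. 1) u v = 2} \<rparr>"

definition adjacency_mat :: "'a pair_pre_digraph \<Rightarrow> 'a list \<Rightarrow> complex mat" where
  "adjacency_mat G vs =
     mat (length vs) (length vs) (\<lambda>(i, j). if (vs ! i, vs ! j) \<in> parcs G then 1 else 0)"

text \<open>
  The choice of the enumeration of the vertices is immaterial, see
  \<open>graph_spectral_radius_eq\<close> below.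
\<close>

definition graph_spectral_radius :: "'a pair_pre_digraph \<Rightarrow> real" where
  "graph_spectral_radius G =
     spectral_radius (adjacency_mat G (SOME vs. distinct vs \<and> set vs = pverts G))"

lemma adjacency_mat_mult_vec:
  assumes "distinct vs" "i < length vs"
  shows "(adjacency_mat G vs *\<^sub>v vec (length vs) (\<lambda>j. f (vs ! j))) $ i =
    (\<Sum>y \<in> {y \<in> set vs. (vs ! i, y) \<in> parcs G}. f y)"
proof -
  have "(adjacency_mat G vs *\<^sub>v vec (length vs) (\<lambda>j. f (vs ! j))) $ i =
      (\<Sum>j = 0..<length vs. if (vs ! i, vs ! j) \<in> parcs G then f (vs ! j) else 0)"
    using assms(2) by (auto simp: adjacency_mat_def scalar_prod_def intro!: sum.cong)
  also have "\<dots> = (\<Sum>y \<in> set vs. if (vs ! i, y) \<in> parcs G then f y else 0)"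
    by (rule sum.reindex_bij_betw[where h = "(!) vs"])
       (use bij_betw_nth[OF assms(1) refl refl] in \<open>simp add: lessThan_atLeast0\<close>)
  also have "\<dots> = (\<Sum>y \<in> {y \<in> set vs. (vs ! i, y) \<in> parcs G}. f y)"
    by (rule sum.inter_filter[symmetric]) simp
  finally show ?thesis .
qed

lemma eigenvalue_adjacency_mat_iff:
  assumes "distinct vs"
  shows "eigenvalue (adjacency_mat G vs) k \<longleftrightarrow>
    (\<exists>f. (\<exists>x \<in> set vs. f x \<noteq> 0) \<and>
         (\<forall>x \<in> set vs. (\<Sum>y \<in> {y \<in> set vs. (x, y) \<in> parcs G}. f y) = k * f x))"
    (is "?L \<longleftrightarrow> ?R")
proof
  have dim: "dim_row (adjacency_mat G vs) = length vs" by (simp add: adjacency_mat_def)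
  assume ?L
  then obtain v where v: "dim_vec v = length vs" "v \<noteq> 0\<^sub>v (length vs)"
      "adjacency_mat G vs *\<^sub>v v = k \<cdot>\<^sub>v v"
    unfolding eigenvalue_def eigenvector_def dim by (metis carrier_vecD)
  define f where "f x = v $ the_inv_into {..<length vs} ((!) vs) x" for x
  have inj: "inj_on ((!) vs) {..<length vs}"
    using assms by (simp add: inj_on_nth)
  have f: "f (vs ! j) = v $ j" if "j < length vs" for j
    using that by (simp add: f_def the_inv_into_f_f[OF inj])
  have vec: "v = vec (length vs) (\<lambda>j. f (vs ! j))"
    using v(1) f by (intro eq_vecI) auto
  show ?R
  proof (intro exI conjI ballI)
    show "\<exists>x \<in> set vs. f x \<noteq> 0"
    proof (rule ccontr)
      assume "\<not> ?thesis"
      then have "v $ j = 0" if "j < length vs" for j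
        using that f[OF that] nth_mem[OF that] by metis
      then have "v = 0\<^sub>v (length vs)" using v(1) by (intro eq_vecI) simp_all
      with v(2) show False ..
    qed
  next
    fix x assume "x \<in> set vs"
    then obtain i where i: "i < length vs" "x = vs ! i" by (auto simp: in_set_conv_nth)
    have "(adjacency_mat G vs *\<^sub>v v) $ i = k * f x"
      unfolding v(3) using v(1) i f[OF i(1)] by simp
    then show "(\<Sum>y \<in> {y \<in> set vs. (x, y) \<in> parcs G}. f y) = k * f x"
      using adjacency_mat_mult_vec[OF assms i(1), of G f, folded vec] i(2) by simp
  qed
next
  assume ?R
  then obtain f x where f: "x \<in> set vs" "f x \<noteq> 0"
      "\<And>x. x \<in> set vs \<Longrightarrow> (\<Sum>y \<in> {y \<in> set vs. (x, y) \<in> parcs G}. f y) = k * f x"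
    by blast
  let ?v = "vec (length vs) (\<lambda>j. f (vs ! j))"
  obtain i where i: "i < length vs" "x = vs ! i" using f(1) by (auto simp: in_set_conv_nth)
  have "?v \<noteq> 0\<^sub>v (length vs)"
  proof
    assume "?v = 0\<^sub>v (length vs)"
    then have "?v $ i = 0" using i(1) by simp
    with i f(2) show False by simp
  qed
  moreover have "adjacency_mat G vs *\<^sub>v ?v = k \<cdot>\<^sub>v ?v"
  proof (rule eq_vecI)
    fix j assume "j < dim_vec (k \<cdot>\<^sub>v ?v)"
    then have "j < length vs" by simp
    then show "(adjacency_mat G vs *\<^sub>v ?v) $ j = (k \<cdot>\<^sub>v ?v) $ j"
      using f(3)[of "vs ! j"] by (subst adjacency_mat_mult_vec[OF assms]) auto
  qed (simp add: adjacency_mat_def)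
  ultimately show ?L
    unfolding eigenvalue_def eigenvector_def
    by (intro exI[of _ ?v] conjI) (simp_all add: adjacency_mat_def)
qed

lemma graph_spectral_radius_eq:
  assumes "distinct vs" "set vs = pverts G"
  shows "graph_spectral_radius G = spectral_radius (adjacency_mat G vs)"
proof -
  define ws where "ws = (SOME vs. distinct vs \<and> set vs = pverts G)"
  have "distinct ws \<and> set ws = pverts G"
    unfolding ws_def by (rule someI[of _ vs]) (use assms in blast)
  then have "spectrum (adjacency_mat G ws) = spectrum (adjacency_mat G vs)"
    unfolding spectrum_def using assms
    by (intro Collect_cong) (simp only: eigenvalue_adjacency_mat_iff)
  then show ?thesis
    by (simp add: graph_spectral_radius_def spectral_radius_def ws_def)
qed

end

theory Submission
  imports Defs "HOL-Analysis.Function_Topology"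
begin

text \<open>
  Let \<open>x\<close> be the positive Perron vector of \<open>U\<^sup>2\<close>, \<open>C\<close> the cycle of \<open>U\<close> and \<open>W\<close> the set of the
  remaining vertices. Choose a cycle vertex \<open>c\<close> for which the sum of \<open>x\<close> over \<open>c\<close> and its two cycle
  neighbours is maximal, and let \<open>T\<close> consist of the cycle with all of \<open>W\<close> attached to \<open>c\<close> as pendant
  vertices; \<open>T\<close> is isomorphic to \<open>U_tilde\<close>. Replacing \<open>U\<^sup>2\<close> by \<open>T\<^sup>2\<close> does not decrease the quadratic
  form at \<open>x\<close>: the pairs inside \<open>C\<close> are unchanged because \<open>C\<close> is the only cycle, all pairs inside
  \<open>W\<close> are adjacent in \<open>T\<^sup>2\<close>, and the neighbours in \<open>C\<close> of a vertex of \<open>W\<close> in \<open>U\<^sup>2\<close> lie among some cycle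
  vertex and its two cycle neighbours. In the case of equality every vertex of \<open>W\<close> is adjacent to
  \<open>C\<close> and the vertices of \<open>W\<close> are pairwise at distance at most 2, so they all hang on the same
  cycle vertex.
\<close>

section \<open>The spectral radius as the maximum of a quadratic form\<close>

text \<open>This is the value of x^T A x for the adjacency matrix A of \<open>R\<close> on
  \<open>V\<close>; ordered pairs are summed, so an edge counts twice. A bare relation in place of a
  graph allows restriction to blocks of vertices.\<close>

definition quad_form :: "'a set \<Rightarrow> 'a rel \<Rightarrow> ('a \<Rightarrow> real) \<Rightarrow> real" where
  "quad_form V R x = (\<Sum>u\<in>V. \<Sum>v\<in>V. if (u, v) \<in> R then x u * x v else 0)"

lemma quad_form_altdef:
  assumes "finite V"
  shows "quad_form V R x = (\<Sum>u\<in>V. x u * (\<Sum>v\<in>{v \<in> V. (u, v) \<in> R}. x v))"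
  using assms unfolding quad_form_def
  by (auto simp: sum.inter_filter sum_distrib_left intro!: sum.cong)

lemma quad_form_scale: "quad_form V R (\<lambda>v. s * x v) = s\<^sup>2 * quad_form V R x"
  unfolding quad_form_def sum_distrib_left
  by (intro sum.cong refl) (simp add: power2_eq_square algebra_simps)

lemma quad_form_le_abs: "quad_form V R x \<le> quad_form V R (\<lambda>v. \<bar>x v\<bar>)"
  unfolding quad_form_def
  by (intro sum_mono) (auto simp: abs_mult[symmetric])

text \<open>The exact expansion of the form along one coordinate direction. The linear coefficient
  is twice the neighbour sum at \<open>w\<close>, so first-order optimality turns it into the
  eigenvalue equation.\<close>

lemma quad_form_add_point:
  assumes "finite V" "sym R" "w \<in> V"
  shows "quad_form V R (\<lambda>v. x v + (if v = w then t else 0)) =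
    quad_form V R x + 2 * t * (\<Sum>v\<in>{v \<in> V. (w, v) \<in> R}. x v) + t\<^sup>2 * of_bool ((w, w) \<in> R)"
proof -
  have "quad_form V R (\<lambda>v. x v + (if v = w then t else 0)) =
    (\<Sum>u\<in>V. \<Sum>v\<in>V. (if (u, v) \<in> R then x u * x v else 0)
       + (if u = w then if (w, v) \<in> R then t * x v else 0 else 0)
       + (if v = w then if (u, w) \<in> R then t * x u else 0 else 0)
       + (if u = w then if v = w then t\<^sup>2 * of_bool ((w, w) \<in> R) else 0 else 0))"
    unfolding quad_form_def
    by (intro sum.cong refl) (auto simp: algebra_simps power2_eq_square)
  also have "\<dots> = quad_form V R x
       + (\<Sum>u\<in>V. if u = w then (\<Sum>v\<in>V. if (w, v) \<in> R then t * x v else 0) else 0)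
       + (\<Sum>u\<in>V. if (u, w) \<in> R then t * x u else 0)
       + (\<Sum>u\<in>V. if u = w then t\<^sup>2 * of_bool ((w, w) \<in> R) else 0)"
    unfolding quad_form_def sum.distrib using assms
    by (intro arg_cong2[where f = "(+)"] refl sum.cong) (auto simp:)
  also have "(\<Sum>u\<in>V. if u = w then (\<Sum>v\<in>V. if (w, v) \<in> R then t * x v else 0) else 0)
      = t * (\<Sum>v\<in>{v \<in> V. (w, v) \<in> R}. x v)"
    using assms by (simp add: sum.inter_filter sum_distrib_left if_distrib cong: if_cong)
  also have "(\<Sum>u\<in>V. if (u, w) \<in> R then t * x u else 0) = t * (\<Sum>v\<in>{v \<in> V. (w, v) \<in> R}. x v)"
    using assms by (auto simp: sum.inter_filter sum_distrib_left intro!: sum.cong dest: symD)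
  finally show ?thesis
    using assms by (simp add:)
qed

text \<open>For small t of the sign of a the linear term wins. The choice t = a / d with d positive
  and larger than b leaves 2 a^2 / d on the left and at most a^2 / d on the right.\<close>

lemma linear_le_quadratic_imp_zero:
  fixes a b :: real
  assumes "\<And>t. 2 * t * a \<le> t\<^sup>2 * b"
  shows "a = 0"
proof (rule ccontr)
  assume "a \<noteq> 0"
  define d where "d = \<bar>b\<bar> + 1"
  have d: "d > 0" "b < d" by (auto simp: d_def)
  have "2 * (a / d) * a \<le> (a / d)\<^sup>2 * b" by (rule assms)
  also have "\<dots> \<le> (a / d)\<^sup>2 * d" using d by (intro mult_left_mono) auto
  finally have "2 * a\<^sup>2 / d \<le> a\<^sup>2 / d"
    using d by (simp add: power2_eq_square)
  then have "2 * a\<^sup>2 \<le> a\<^sup>2" using d by (simp add: divide_le_cancel)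
  then show False using \<open>a \<noteq> 0\<close> by simp
qed

text \<open>Compactness of the unit sphere. Functions are forced to vanish outside \<open>V\<close>,
  which places them in a product of the compact sets [-1, 1] and {0}; the form does not see the
  values outside \<open>V\<close>.\<close>

lemma quad_form_attains_max:
  assumes V: "finite V" "V \<noteq> {}"
  obtains x where "(\<Sum>v\<in>V. (x v)\<^sup>2) = 1"
    "\<And>y. (\<Sum>v\<in>V. (y v)\<^sup>2) = 1 \<Longrightarrow> quad_form V R y \<le> quad_form V R x"
proof -
  define B :: "('a \<Rightarrow> real) set" where "B = PiE UNIV (\<lambda>v. if v \<in> V then {-1..1} else {0})"
  define K where "K = B \<inter> {x. (\<Sum>v\<in>V. (x v)\<^sup>2) = 1}"
  have "compactin (product_topology (\<lambda>_. euclidean) UNIV) B"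
    unfolding B_def compactin_PiE by auto
  then have "compact B" by (simp add: euclidean_product_topology)
  moreover have "closed {x :: 'a \<Rightarrow> real. (\<Sum>v\<in>V. (x v)\<^sup>2) = 1}"
    by (intro closed_Collect_eq continuous_intros continuous_on_product_coordinates)
  ultimately have "compact K" unfolding K_def by (rule compact_Int_closed)
  moreover have in_K: "(\<lambda>v. if v \<in> V then y v else 0) \<in> K" if y: "(\<Sum>v\<in>V. (y v)\<^sup>2) = 1" for y
  proof -
    have "\<bar>y v\<bar> \<le> 1" if "v \<in> V" for v
    proof -
      have "(y v)\<^sup>2 \<le> (\<Sum>v\<in>V. (y v)\<^sup>2)" using V that by (intro member_le_sum) auto
      then show ?thesis using y abs_square_le_1 by auto
    qed
    then show ?thesis using y by (auto simp: K_def B_def abs_le_iff)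
  qed
  moreover have "K \<noteq> {}"
  proof -
    obtain w where "w \<in> V" using V by blast
    then have "(\<Sum>v\<in>V. (if v = w then 1 else 0 :: real)\<^sup>2) = 1"
      using V by (simp add: if_distrib[of "\<lambda>t. t\<^sup>2"] cong: if_cong)
    from in_K[OF this] show ?thesis by blast
  qed
  moreover have "continuous_on K (quad_form V R)"
  proof -
    have "continuous_on K (\<lambda>x :: 'a \<Rightarrow> real. if (u, v) \<in> R then x u * x v else 0)" for u v
      by (cases "(u, v) \<in> R")
         (auto intro!: continuous_intros continuous_on_subset[OF continuous_on_product_coordinates])
    then show ?thesis unfolding quad_form_def[abs_def] by (intro continuous_intros)
  qed
  ultimately obtain x where x: "x \<in> K" "\<And>y. y \<in> K \<Longrightarrow> quad_form V R y \<le> quad_form V R x"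
    using continuous_attains_sup[of K "quad_form V R"] by blast
  show thesis
  proof (rule that)
    show "(\<Sum>v\<in>V. (x v)\<^sup>2) = 1" using x(1) by (simp add: K_def)
  next
    fix y :: "'a \<Rightarrow> real" assume "(\<Sum>v\<in>V. (y v)\<^sup>2) = 1"
    from x(2)[OF in_K[OF this]] show "quad_form V R y \<le> quad_form V R x"
      by (simp add: quad_form_def cong: if_cong)
  qed
qed

text \<open>Taking absolute values of a maximiser on the unit sphere keeps its norm and does not
  lower the form, so a nonnegative maximiser \<open>x\<close> exists. \<open>M\<close> is the
  maximum, and the eigenvalue equation is the first-order condition at \<open>x\<close>.\<close>

lemma symmetric_relation_perron:
  assumes V: "finite V" "V \<noteq> {}" and "sym R"
  obtains M x where "\<And>v. 0 \<le> x v" "\<exists>v\<in>V. x v \<noteq> 0"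
    "\<And>u. u \<in> V \<Longrightarrow> (\<Sum>v\<in>{v \<in> V. (u, v) \<in> R}. x v) = M * x u"
    "\<And>y. quad_form V R y \<le> M * (\<Sum>v\<in>V. (y v)\<^sup>2)"
proof -
  obtain z where z: "(\<Sum>v\<in>V. (z v)\<^sup>2) = 1"
    "\<And>y. (\<Sum>v\<in>V. (y v)\<^sup>2) = 1 \<Longrightarrow> quad_form V R y \<le> quad_form V R z"
    by (rule quad_form_attains_max[OF V, of R]) blast
  define x where "x v = \<bar>z v\<bar>" for v
  define M where "M = quad_form V R x"
  have x1: "(\<Sum>v\<in>V. (x v)\<^sup>2) = 1" using z(1) by (simp add: x_def)
  have xmax: "quad_form V R y \<le> M" if "(\<Sum>v\<in>V. (y v)\<^sup>2) = 1" for y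
    using z(2)[OF that] quad_form_le_abs[of V R z] by (simp add: M_def x_def[abs_def])
  have bound: "quad_form V R y \<le> M * (\<Sum>v\<in>V. (y v)\<^sup>2)" for y
  proof (cases "(\<Sum>v\<in>V. (y v)\<^sup>2) = 0")
    case True
    then have "\<And>v. v \<in> V \<Longrightarrow> y v = 0" using V by (simp add: sum_nonneg_eq_0_iff)
    then show ?thesis using True by (simp add: quad_form_def)
  next
    case False
    define N where "N = (\<Sum>v\<in>V. (y v)\<^sup>2)"
    have N: "N > 0" using False by (simp add: N_def sum_nonneg less_le)
    define s where "s = inverse (sqrt N)"
    have s: "s\<^sup>2 = inverse N" using N by (simp add: s_def power_inverse)
    have "(\<Sum>v\<in>V. (s * y v)\<^sup>2) = 1"
      using N s by (simp add: power_mult_distrib sum_distrib_left[symmetric] N_def[symmetric])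
    from xmax[OF this] have "inverse N * quad_form V R y \<le> M"
      by (simp add: quad_form_scale s)
    then show ?thesis using N by (simp add: N_def[symmetric] field_simps)
  qed
  show thesis
  proof (rule that)
    show "0 \<le> x v" for v by (simp add: x_def)
    show "\<exists>v\<in>V. x v \<noteq> 0"
    proof (rule ccontr)
      assume "\<not> ?thesis"
      then have "(\<Sum>v\<in>V. (x v)\<^sup>2) = 0" by simp
      with x1 show False by simp
    qed
    show "quad_form V R y \<le> M * (\<Sum>v\<in>V. (y v)\<^sup>2)" for y by (rule bound)
  next
    fix u assume u: "u \<in> V"
    let ?s = "\<Sum>v\<in>{v \<in> V. (u, v) \<in> R}. x v"
    \<comment> \<open>The bound is tested at \<open>x\<close> with t added at \<open>u\<close>: the
      squared norm becomes 1 + 2 t x(u) + t^2, and the constant terms \<open>M\<close> on both sides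
      cancel.\<close>
    have "2 * t * (?s - M * x u) \<le> t\<^sup>2 * (M - of_bool ((u, u) \<in> R))" for t
    proof -
      have "(\<Sum>v\<in>V. (x v + (if v = u then t else 0))\<^sup>2)
          = (\<Sum>v\<in>V. (x v)\<^sup>2 + (if v = u then 2 * t * x u + t\<^sup>2 else 0))"
        by (intro sum.cong) (auto simp: power2_eq_square algebra_simps)
      also have "\<dots> = 1 + (2 * t * x u + t\<^sup>2)"
        using V u x1 by (simp add: sum.distrib)
      finally show ?thesis
        using bound[of "\<lambda>v. x v + (if v = u then t else 0)"]
          quad_form_add_point[OF V(1) \<open>sym R\<close> u, of x t]
        by (simp add: M_def[symmetric] algebra_simps)
    qed
    from linear_le_quadratic_imp_zero[OF this] show "?s = M * x u" by simp
  qed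
qed

text \<open>By symmetry the two mixed blocks agree. The cross term is grouped by vertices of
  \<open>B\<close> because each vertex off the cycle is later compared through its neighbours on the
  cycle.\<close>

lemma quad_form_Un_disjoint:
  assumes "finite A" "finite B" "A \<inter> B = {}" "sym R"
  shows "quad_form (A \<union> B) R x = quad_form A R x + quad_form B R x
    + 2 * (\<Sum>u\<in>B. x u * (\<Sum>v\<in>{v \<in> A. (u, v) \<in> R}. x v))"
proof -
  let ?f = "\<lambda>u v. if (u, v) \<in> R then x u * x v else 0"
  have BA: "(\<Sum>u\<in>B. \<Sum>v\<in>A. ?f u v) = (\<Sum>u\<in>B. x u * (\<Sum>v\<in>{v \<in> A. (u, v) \<in> R}. x v))"
    using assms by (simp add: sum.inter_filter sum_distrib_left if_distrib cong: if_cong)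
  have "(\<Sum>u\<in>A. \<Sum>v\<in>B. ?f u v) = (\<Sum>v\<in>B. \<Sum>u\<in>A. ?f u v)" by (rule sum.swap)
  also have "\<dots> = (\<Sum>u\<in>B. \<Sum>v\<in>A. ?f u v)"
    using assms(4) by (intro sum.cong refl) (auto dest: symD)
  finally have AB: "(\<Sum>u\<in>A. \<Sum>v\<in>B. ?f u v) = (\<Sum>u\<in>B. \<Sum>v\<in>A. ?f u v)" .
  have "quad_form (A \<union> B) R x =
      (\<Sum>u\<in>A. (\<Sum>v\<in>A. ?f u v) + (\<Sum>v\<in>B. ?f u v)) + (\<Sum>u\<in>B. (\<Sum>v\<in>A. ?f u v) + (\<Sum>v\<in>B. ?f u v))"
    unfolding quad_form_def using assms by (simp add: sum.union_disjoint)
  then show ?thesis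
    unfolding sum.distrib AB BA quad_form_def by simp
qed

lemma quad_form_mono:
  assumes "\<And>v. v \<in> S \<Longrightarrow> 0 \<le> x v"
    and "\<And>u v. u \<in> S \<Longrightarrow> v \<in> S \<Longrightarrow> (u, v) \<in> R \<Longrightarrow> (u, v) \<in> R'"
  shows "quad_form S R x \<le> quad_form S R' x"
  unfolding quad_form_def using assms by (intro sum_mono) auto

text \<open>One additional pair is a strict gain because the vector is positive; this detects
  missing adjacencies in the case of equality.\<close>

lemma quad_form_strict_mono:
  assumes "finite S" and pos: "\<And>v. v \<in> S \<Longrightarrow> 0 < x v"
    and sub: "\<And>u v. u \<in> S \<Longrightarrow> v \<in> S \<Longrightarrow> (u, v) \<in> R \<Longrightarrow> (u, v) \<in> R'"
    and "a \<in> S" "b \<in> S" "(a, b) \<in> R'" "(a, b) \<notin> R"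
  shows "quad_form S R x < quad_form S R' x"
proof -
  have le: "(if (u, v) \<in> R then x u * x v else 0) \<le> (if (u, v) \<in> R' then x u * x v else 0)"
    if "u \<in> S" "v \<in> S" for u v
    using that pos sub by (auto simp: less_imp_le)
  have "(\<Sum>v\<in>S. if (a, v) \<in> R then x a * x v else 0) < (\<Sum>v\<in>S. if (a, v) \<in> R' then x a * x v else 0)"
    using assms le by (intro sum_strict_mono_ex1) (auto intro!: bexI[of _ b])
  then show ?thesis
    unfolding quad_form_def using assms(1,4) le
    by (intro sum_strict_mono_ex1) (auto intro!: bexI[of _ a] sum_mono)
qed

text \<open>Identifies the variational maximum \<open>M\<close> with the spectral radius. If f is a
  complex eigenvector for k, the triangle inequality bounds |k| times the squared norm of f by the
  form at |f|, so |k| is at most \<open>M\<close>. Conversely \<open>x\<close> is itself an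
  eigenvector for \<open>M\<close>.\<close>

lemma graph_spectral_radius_perron:
  assumes V: "finite (pverts G)" "pverts G \<noteq> {}" and sym: "sym (parcs G)"
  obtains x where "\<And>v. 0 \<le> x v" "\<exists>v\<in>pverts G. x v \<noteq> 0"
    "\<And>u. u \<in> pverts G \<Longrightarrow>
      (\<Sum>v\<in>{v \<in> pverts G. (u, v) \<in> parcs G}. x v) = graph_spectral_radius G * x u"
    "\<And>y. quad_form (pverts G) (parcs G) y \<le> graph_spectral_radius G * (\<Sum>v\<in>pverts G. (y v)\<^sup>2)"
proof -
  let ?V = "pverts G" and ?R = "parcs G"
  obtain M x where x: "\<And>v. 0 \<le> x v" "\<exists>v\<in>?V. x v \<noteq> 0"
    "\<And>u. u \<in> ?V \<Longrightarrow> (\<Sum>v\<in>{v \<in> ?V. (u, v) \<in> ?R}. x v) = M * x u"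
    "\<And>y. quad_form ?V ?R y \<le> M * (\<Sum>v\<in>?V. (y v)\<^sup>2)"
    by (rule symmetric_relation_perron[OF V sym]) blast
  obtain vs where vs: "distinct vs" "set vs = ?V"
    using finite_distinct_list[OF V(1)] by blast
  define A where "A = adjacency_mat G vs"
  have A: "A \<in> carrier_mat (length vs) (length vs)" by (simp add: A_def adjacency_mat_def)
  have "0 < length vs" using vs V by auto
  note sr = spectral_radius_mem_max[OF A this]
  have norm_le: "norm k \<le> M" if k: "eigenvalue A k" for k
  proof -
    obtain f w where f: "w \<in> ?V" "f w \<noteq> 0"
        "\<And>x. x \<in> ?V \<Longrightarrow> (\<Sum>y\<in>{y \<in> ?V. (x, y) \<in> ?R}. f y) = k * f x"
      using k unfolding A_def eigenvalue_adjacency_mat_iff[OF vs(1)] vs(2) by blast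
    define N where "N = (\<Sum>v\<in>?V. (norm (f v))\<^sup>2)"
    have "0 < (norm (f w))\<^sup>2" using f by simp
    also have "\<dots> \<le> N" unfolding N_def using f V by (intro member_le_sum) auto
    finally have N: "0 < N" .
    have "norm k * N = (\<Sum>u\<in>?V. norm (f u) * norm (k * f u))"
      by (simp add: N_def sum_distrib_left norm_mult power2_eq_square algebra_simps)
    also have "\<dots> = (\<Sum>u\<in>?V. norm (f u) * norm (\<Sum>y\<in>{y \<in> ?V. (u, y) \<in> ?R}. f y))"
      using f(3) by simp
    also have "\<dots> \<le> (\<Sum>u\<in>?V. norm (f u) * (\<Sum>y\<in>{y \<in> ?V. (u, y) \<in> ?R}. norm (f y)))"
      by (intro sum_mono mult_left_mono norm_sum) auto
    also have "\<dots> = quad_form ?V ?R (\<lambda>v. norm (f v))"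
      using V by (simp add: quad_form_altdef)
    also have "\<dots> \<le> M * N" unfolding N_def by (rule x(4))
    finally show ?thesis using N by simp
  qed
  have "eigenvalue A (complex_of_real M)"
    unfolding A_def eigenvalue_adjacency_mat_iff[OF vs(1)] vs(2)
    by (rule exI[of _ "\<lambda>v. complex_of_real (x v)"])
       (use x(2,3) in \<open>simp add: of_real_sum[symmetric] of_real_mult[symmetric] del: of_real_sum of_real_mult\<close>)
  then have "\<bar>M\<bar> \<in> norm ` spectrum A"
    unfolding spectrum_def by (auto intro: image_eqI[of _ _ "complex_of_real M"])
  then have "\<bar>M\<bar> \<le> spectral_radius A" by (rule sr(2))
  moreover have "spectral_radius A \<le> M" using sr(1) norm_le by (auto simp: spectrum_def)
  ultimately have "graph_spectral_radius G = M"
    by (simp add: graph_spectral_radius_eq[OF vs] A_def)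
  with x show thesis by (intro that[of x]) simp_all
qed

section \<open>Squares of graphs and isomorphisms\<close>

text \<open>Distances are replaced by walks of one or two arcs, the only form needed below;
  \<open>parcs_graph_square\<close> gives the agreement with \<open>graph_square\<close>.\<close>

definition square_rel :: "'a rel \<Rightarrow> 'a rel" where
  "square_rel E = {(u, v). u \<noteq> v \<and> ((u, v) \<in> E \<or> (\<exists>w. (u, w) \<in> E \<and> (w, v) \<in> E))}"

lemma sym_square_rel: "sym E \<Longrightarrow> sym (square_rel E)"
  unfolding square_rel_def sym_def by blast

lemma (in pair_wf_digraph) distance_eq_2_iff:
  "\<mu> (\<lambda>_. 1) u v = ereal 2 \<longleftrightarrow>
     u \<noteq> v \<and> (u, v) \<notin> parcs G \<and> (\<exists>w. (u, w) \<in> parcs G \<and> (w, v) \<in> parcs G)" (is "?L \<longleftrightarrow> ?R")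
  if uv: "u \<in> pverts G" "v \<in> pverts G"
proof -
  have cost: "awalk_cost (\<lambda>_. 1) p = real (length p)" for p :: "('a \<times> 'a) list"
    by (induction p) auto
  have walk0: "awalk u [] v \<longleftrightarrow> u = v" using uv by (auto simp: awalk_Nil_iff)
  have walk1: "awalk u [(u, v)] v \<longleftrightarrow> (u, v) \<in> parcs G"
    using uv by (auto simp: awalk_def)
  have walk2: "awalk u [(u, w), (w, v)] v \<longleftrightarrow> (u, w) \<in> parcs G \<and> (w, v) \<in> parcs G" for w
    using uv by (auto simp: awalk_def)
  have short: "p = [] \<or> p = [(u, v)] \<or> (\<exists>w. p = [(u, w), (w, v)])"
    if "awalk u p v" "length p \<le> 2" for p
    using that by (cases p; cases "tl p"; cases "tl (tl p)") (auto simp: awalk_def)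
  show ?thesis
  proof
    assume L: ?L
    have lower: "2 \<le> length p" if "awalk u p v" for p
      using min_cost_le_walk_cost[OF that, of "\<lambda>_. 1"] L by (simp add: cost)
    \<comment> \<open>A strict upper bound on the infimum yields a concrete walk of cost below 3;
      integrality then gives length at most 2.\<close>
    have "\<mu> (\<lambda>_. 1) u v < ereal 3" using L by simp
    then obtain p where p: "awalk u p v" "real (length p) < 3"
      unfolding \<mu>_def INF_less_iff cost by auto
    then have "length p \<le> 2" by linarith
    with p(1) short[of p] lower[of p] lower[of "[]"] lower[of "[(u, v)]"] show ?R
      using walk0 walk1 walk2 by auto
  next
    assume R: ?R
    then obtain w where w: "awalk u [(u, w), (w, v)] v" using walk2 by blast
    have "2 \<le> length p" if p: "awalk u p v" for p
    proof (rule ccontr)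
      assume "\<not> 2 \<le> length p"
      with short[OF p] have "p = [] \<or> p = [(u, v)]" by auto
      with p R walk0 walk1 show False by auto
    qed
    then have "ereal 2 \<le> \<mu> (\<lambda>_. 1) u v"
      unfolding \<mu>_def cost by (intro INF_greatest) auto
    moreover have "\<mu> (\<lambda>_. 1) u v \<le> ereal 2"
      using min_cost_le_walk_cost[OF w, of "\<lambda>_. 1"] by (simp add: cost)
    ultimately have "\<mu> (\<lambda>_. 1) u v = ereal 2" by (rule antisym[rotated])
    then show ?L by simp
  qed
qed

lemma pverts_graph_square [simp]: "pverts (graph_square G) = pverts G"
  by (simp add: graph_square_def)

lemma parcs_graph_square:
  assumes "pair_graph G"
  shows "parcs (graph_square G) = square_rel (parcs G)"
proof -
  interpret pair_graph G by fact
  show ?thesis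
    unfolding graph_square_def square_rel_def
    by (auto simp: distance_eq_2_iff wellformed' dest: no_loops')
qed

lemma graph_square_perron:
  assumes "pair_graph G" "pverts G \<noteq> {}"
  obtains x where "\<And>v. 0 \<le> x v" "\<exists>v\<in>pverts G. x v \<noteq> 0"
    "\<And>u. u \<in> pverts G \<Longrightarrow> (\<Sum>v\<in>{v \<in> pverts G. (u, v) \<in> square_rel (parcs G)}. x v)
      = graph_spectral_radius (graph_square G) * x u"
    "\<And>y. quad_form (pverts G) (square_rel (parcs G)) y
      \<le> graph_spectral_radius (graph_square G) * (\<Sum>v\<in>pverts G. (y v)\<^sup>2)"
proof -
  interpret pair_graph G by fact
  have "sym (parcs G)" using arcs_symmetric by (auto simp: sym_def)
  then have sym: "sym (parcs (graph_square G))"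
    unfolding parcs_graph_square[OF assms(1)] by (rule sym_square_rel)
  have verts: "finite (pverts (graph_square G))" "pverts (graph_square G) \<noteq> {}"
    using assms(2) pair_finite_verts by simp_all
  obtain x where
    "\<And>v. 0 \<le> x v" "\<exists>v\<in>pverts (graph_square G). x v \<noteq> 0"
    "\<And>u. u \<in> pverts (graph_square G) \<Longrightarrow>
      (\<Sum>v\<in>{v \<in> pverts (graph_square G). (u, v) \<in> parcs (graph_square G)}. x v)
        = graph_spectral_radius (graph_square G) * x u"
    "\<And>y. quad_form (pverts (graph_square G)) (parcs (graph_square G)) y
      \<le> graph_spectral_radius (graph_square G) * (\<Sum>v\<in>pverts (graph_square G). (y v)\<^sup>2)"
    by (rule graph_spectral_radius_perron[OF verts sym]) blast
  then show thesis
    unfolding pverts_graph_square parcs_graph_square[OF assms(1)] by (rule that)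
qed

section \<open>Isomorphism invariance of the spectral radius\<close>

lemma graph_spectral_radius_cong:
  assumes fin: "finite (pverts G)" and f: "bij_betw f (pverts G) (pverts H)"
    and arcs: "\<And>u v. u \<in> pverts G \<Longrightarrow> v \<in> pverts G \<Longrightarrow>
      (f u, f v) \<in> parcs H \<longleftrightarrow> (u, v) \<in> parcs G"
  shows "graph_spectral_radius G = graph_spectral_radius H"
proof -
  obtain vs where vs: "distinct vs" "set vs = pverts G"
    using finite_distinct_list[OF fin] by blast
  have "distinct (map f vs)" "set (map f vs) = pverts H"
    using vs f by (auto simp: distinct_map bij_betw_def)
  note H = graph_spectral_radius_eq[OF this]
  have "(f (vs ! i), f (vs ! j)) \<in> parcs H \<longleftrightarrow> (vs ! i, vs ! j) \<in> parcs G"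
    if "i < length vs" "j < length vs" for i j
    using arcs[of "vs ! i" "vs ! j"] that unfolding vs(2)[symmetric] by simp
  \<comment> \<open>Enumerating \<open>H\<close> in the order transported by \<open>f\<close> gives
    literally the same matrix.\<close>
  then have "adjacency_mat H (map f vs) = adjacency_mat G vs"
    unfolding adjacency_mat_def by (intro eq_matI) auto
  then show ?thesis using graph_spectral_radius_eq[OF vs] H by simp
qed

lemma digraph_iso_with_projI:
  assumes "pair_wf_digraph G" "inj_on f (pverts G)" "pverts H = f ` pverts G"
    "parcs H = map_prod f f ` parcs G"
  shows "digraph_iso (with_proj G) (with_proj H)"
proof -
  interpret pair_wf_digraph G by fact
  let ?h = "\<lparr> iso_verts = f, iso_arcs = map_prod f f, iso_head = snd, iso_tail = fst \<rparr>"
  have "inj_on (map_prod f f) (parcs G)"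
  proof (rule inj_onI, clarsimp)
    fix a b a' b' assume "(a, b) \<in> parcs G" "(a', b') \<in> parcs G" "f a = f a'" "f b = f b'"
    then show "a = a' \<and> b = b'"
      using assms(2) wellformed' by (meson inj_onD)
  qed
  then have "digraph_isomorphism ?h"
    unfolding digraph_isomorphism_def using assms by (auto intro: wf_digraph)
  moreover have "with_proj H = app_iso ?h (with_proj G)"
    using assms by (simp add: app_iso_def with_proj_def)
  ultimately show ?thesis unfolding digraph_iso_def by blast
qed

text \<open>An isomorphism carries its own arc map and new head and tail maps. Since the image is
  again a pair digraph, these must be \<open>snd\<close> and \<open>fst\<close>, and compatibility
  with the vertex map then determines the arc map.\<close>

lemma digraph_iso_with_projE:
  assumes "digraph_iso (with_proj G) (with_proj H)"
  obtains f where "inj_on f (pverts G)" "pverts H = f ` pverts G" "parcs H = map_prod f f ` parcs G"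
proof -
  obtain h where h: "pre_digraph.digraph_isomorphism (with_proj G) h"
    and H: "with_proj H = app_iso h (with_proj G)"
    using assms unfolding digraph_iso_def by blast
  have H': "pverts H = iso_verts h ` pverts G" "parcs H = iso_arcs h ` parcs G"
    "iso_tail h = fst" "iso_head h = snd"
    using H by (auto simp: app_iso_def with_proj_def)
  have "iso_arcs h e = map_prod (iso_verts h) (iso_verts h) e" if "e \<in> parcs G" for e
    using h that unfolding pre_digraph.digraph_isomorphism_def
    by (cases e) (auto simp: H' prod_eq_iff)
  then have "parcs H = map_prod (iso_verts h) (iso_verts h) ` parcs G"
    unfolding H'(2) by (intro image_cong) auto
  moreover have "inj_on (iso_verts h) (pverts G)"
    using h unfolding pre_digraph.digraph_isomorphism_def by simp
  ultimately show thesis using that H'(1) by blast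
qed

lemma digraph_iso_square_spectral_radius_eq:
  assumes G: "pair_graph G" and iso: "digraph_iso (with_proj G) (with_proj H)"
  shows "graph_spectral_radius (graph_square G) = graph_spectral_radius (graph_square H)"
proof -
  interpret pair_graph G by fact
  obtain f where f: "inj_on f (pverts G)" "pverts H = f ` pverts G" "parcs H = map_prod f f ` parcs G"
    using digraph_iso_with_projE[OF iso] .
  have arcs: "(f u, f v) \<in> parcs H \<longleftrightarrow> (u, v) \<in> parcs G" if "u \<in> pverts G" "v \<in> pverts G" for u v
    using that f(1) unfolding f(3) by (auto simp: inj_on_eq_iff wellformed')
  \<comment> \<open>Nothing is assumed of \<open>H\<close>, so well-formedness and symmetry are
    transported along \<open>f\<close> before \<open>parcs_graph_square\<close> can be applied to
    it.\<close>
  have H: "pair_graph H"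
  proof
    show "finite (pverts H)" "finite (parcs H)"
      by (auto simp: f pair_finite_verts pair_finite_arcs)
    show "fst e \<in> pverts H" "snd e \<in> pverts H" if "e \<in> parcs H" for e
      using that by (auto simp: f wellformed')
    show "fst e \<noteq> snd e" if "e \<in> parcs H" for e
      using that f(1) by (auto simp: f(3) inj_on_eq_iff wellformed' dest: no_loops')
    show "symmetric (with_proj H)"
      unfolding symmetric_def sym_def with_proj_simps f(3)
      by (auto simp: image_iff intro: bexI[OF _ arcs_symmetric])
  qed
  show ?thesis
  proof (rule graph_spectral_radius_cong)
    show "finite (pverts (graph_square G))" by (simp add: pair_finite_verts)
    show "bij_betw f (pverts (graph_square G)) (pverts (graph_square H))"
      using f by (simp add: bij_betw_def)
    fix u v assume "u \<in> pverts (graph_square G)" "v \<in> pverts (graph_square G)"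
    then have uv: "u \<in> pverts G" "v \<in> pverts G" by simp_all
    have "(\<exists>w. (f u, w) \<in> parcs H \<and> (w, f v) \<in> parcs H) \<longleftrightarrow>
        (\<exists>w. (u, w) \<in> parcs G \<and> (w, v) \<in> parcs G)" (is "?L \<longleftrightarrow> ?R")
    proof
      assume ?L
      then obtain w' where w': "(f u, w') \<in> parcs H" "(w', f v) \<in> parcs H" by blast
      then obtain w where "w \<in> pverts G" "w' = f w"
        unfolding f(3) by (auto dest: wellformed')
      with w' uv show ?R using arcs by blast
    next
      assume ?R
      then obtain w where w: "(u, w) \<in> parcs G" "(w, v) \<in> parcs G" by blast
      then have "w \<in> pverts G" using wellformed' by blast
      with w uv show ?L using arcs by blast
    qed
    moreover have "f u = f v \<longleftrightarrow> u = v" using uv f(1) by (simp add: inj_on_eq_iff)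
    ultimately show "(f u, f v) \<in> parcs (graph_square H) \<longleftrightarrow> (u, v) \<in> parcs (graph_square G)"
      unfolding parcs_graph_square[OF G] parcs_graph_square[OF H] square_rel_def
      using arcs[OF uv] by simp
  qed
qed

section \<open>Cycles as vertex sequences\<close>

text \<open>A cycle as a list without repeated end point: new cycles can then be built by
  concatenating vertex lists, which is awkward with the arc lists of \<open>cycle\<close>.\<close>

definition vertex_cycle :: "'a rel \<Rightarrow> 'a list \<Rightarrow> bool" where
  "vertex_cycle E ys \<longleftrightarrow> distinct ys \<and> 3 \<le> length ys \<and>
     successively (\<lambda>u v. (u, v) \<in> E) ys \<and> (last ys, hd ys) \<in> E"

text \<open>The end \<open>z\<close> is kept apart from the start so that the induction can advance
  the start; a closed walk is the instance in which \<open>z\<close> is \<open>y\<close>.\<close>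

lemma successively_imp_walk:
  assumes "successively (\<lambda>u v. (u, v) \<in> E) (y # ys)" "(last (y # ys), z) \<in> E"
  defines "p \<equiv> zip (y # ys) (ys @ [z])"
  shows "pcas y p z \<and> set p \<subseteq> E \<and> pawalk_verts y p = y # ys @ [z]"
  using assms(1,2) unfolding p_def
proof (induction ys arbitrary: y)
  case (Cons a ys)
  then show ?case by (cases ys) auto
qed auto

text \<open>Two facts about the edge set are exported: covering the vertices excludes ears, and
  containing the closing edge excludes chords.\<close>

lemma vertex_cycle_imp_cycle_edge_set:
  assumes G: "pair_wf_digraph G" and ys: "vertex_cycle (parcs G) ys"
  obtains S where "S \<in> cycle_edge_sets G" "set ys \<subseteq> \<Union>S" "{last ys, hd ys} \<in> S"
proof -
  interpret pair_wf_digraph G by fact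
  obtain y ys' where y: "ys = y # ys'" using ys by (cases ys) (auto simp: vertex_cycle_def)
  define p where "p = zip (y # ys') (ys' @ [y])"
  have walk: "pcas y p y" "set p \<subseteq> parcs G" "pawalk_verts y p = y # ys' @ [y]"
    using successively_imp_walk[of "parcs G" y ys' y] ys
    unfolding p_def y vertex_cycle_def by auto
  have len: "length p = length ys" by (simp add: p_def y)
  have "y \<in> pverts G" using ys wellformed' unfolding vertex_cycle_def y by auto
  then have "awalk y p y" using walk by (simp add: awalk_def)
  moreover have "distinct (tl (pawalk_verts y p))"
    using ys unfolding walk(3) by (auto simp: y vertex_cycle_def)
  ultimately have "cycle p"
    unfolding cycle_def using ys len by (auto simp: vertex_cycle_def)
  moreover have "3 \<le> length p" using ys len by (simp add: vertex_cycle_def)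
  ultimately have S: "(\<lambda>(u, v). {u, v}) ` set p \<in> cycle_edge_sets G"
    unfolding cycle_edge_sets_def by blast
  have "map fst p = ys" by (simp add: p_def y)
  then have "set ys = fst ` set p" by (metis set_map)
  then have cover: "set ys \<subseteq> \<Union>((\<lambda>(u, v). {u, v}) ` set p)" by force
  have "last p = (last ys, hd ys)"
    unfolding p_def y using last_zip[of "y # ys'" "ys' @ [y]"] by simp
  then have "(last ys, hd ys) \<in> set p" using last_in_set[of p] len y by fastforce
  then have "{last ys, hd ys} \<in> (\<lambda>(u, v). {u, v}) ` set p" by force
  with S cover show thesis by (rule that)
qed

section \<open>Periodic parametrization of a cycle\<close>

lemma pcas_nth_fst:
  assumes "pcas u p v" "i < length p"
  shows "fst (p ! i) = (u # map snd p) ! i"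
  using assms by (induction p arbitrary: u i) (auto simp: nth_Cons split: nat.splits)

lemma pcas_last: "pcas u p v \<Longrightarrow> v = last (u # map snd p)"
  by (induction p arbitrary: u) auto

lemma pawalk_verts_pcas: "pcas u p v \<Longrightarrow> pawalk_verts u p = u # map snd p"
  by (induction p arbitrary: u) auto

lemma cycle_parametrization:
  assumes "pair_wf_digraph G" "pre_digraph.cycle (with_proj G) p" "3 \<le> length p"
  obtains c where "\<And>i j. c i = c j \<longleftrightarrow> i mod length p = j mod length p"
    "\<And>i. (c i, c (Suc i)) \<in> parcs G"
    "(\<lambda>(u, v). {u, v}) ` set p = range (\<lambda>i. {c i, c (Suc i)})"
proof -
  interpret pair_wf_digraph G by fact
  define g where "g = length p"
  have g: "3 \<le> g" using assms(3) by (simp add: g_def)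
  obtain u where u: "pcas u p u" "set p \<subseteq> parcs G" "distinct (tl (pawalk_verts u p))"
    using assms(2) unfolding cycle_def by (auto simp: awalk_def)
  have dist: "distinct (map snd p)" using u by (simp add: pawalk_verts_pcas)
  have last: "u = snd (p ! (g - 1))"
    using pcas_last[OF u(1)] g by (cases p rule: rev_cases) (auto simp: g_def nth_append)
  define c where "c i = snd (p ! (i mod g))" for i
  \<comment> \<open>As \<open>c i\<close> is the head of arc i mod g, the arc from
    \<open>c i\<close> to \<open>c (Suc i)\<close> carries the next index. At the wraparound the
    tail of the first arc is \<open>u\<close>, the head of the last one.\<close>
  have step: "p ! (Suc i mod g) = (c i, c (Suc i))" for i
  proof -
    have "fst (p ! (Suc i mod g)) = c i"
    proof (cases "Suc (i mod g) = g")
      case True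
      then have "Suc i mod g = 0" by (simp add: mod_Suc)
      moreover have "i mod g = g - 1" using True by linarith
      moreover have "fst (p ! 0) = u" using pcas_nth_fst[OF u(1), of 0] g by (cases p) (auto simp: g_def)
      ultimately show ?thesis using last by (simp add: c_def)
    next
      case False
      then have "Suc i mod g = Suc (i mod g)" by (simp add: mod_Suc)
      moreover have "Suc (i mod g) < g" using False g mod_less_divisor[of g i] by linarith
      ultimately show ?thesis using pcas_nth_fst[OF u(1), of "Suc (i mod g)"]
        by (auto simp: c_def g_def)
    qed
    then show ?thesis by (simp add: c_def prod_eq_iff)
  qed
  have set_p: "set p = range (\<lambda>i. (c i, c (Suc i)))"
  proof
    show "set p \<subseteq> range (\<lambda>i. (c i, c (Suc i)))"
    proof
      fix e assume "e \<in> set p"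
      then obtain k where k: "k < g" "e = p ! k" by (auto simp: in_set_conv_nth g_def)
      \<comment> \<open>Adding g before subtracting 1 gives a predecessor of k modulo g that is also
        correct for k = 0.\<close>
      then have "Suc (k + g - 1) mod g = k" using g by simp
      with step[of "k + g - 1"] k show "e \<in> range (\<lambda>i. (c i, c (Suc i)))" by auto
    qed
    show "range (\<lambda>i. (c i, c (Suc i))) \<subseteq> set p"
    proof (rule image_subsetI)
      fix i
      have "Suc i mod g < length p" unfolding g_def[symmetric] using g by simp
      then show "(c i, c (Suc i)) \<in> set p" unfolding step[symmetric] by (rule nth_mem)
    qed
  qed
  show thesis
  proof (rule that)
    fix i j
    have "k mod g < length p" for k unfolding g_def[symmetric] using g by simp
    then show "c i = c j \<longleftrightarrow> i mod length p = j mod length p"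
      using nth_eq_iff_index_eq[OF dist, of "i mod g" "j mod g"]
      by (simp add: c_def flip: g_def)
  next
    show "(c i, c (Suc i)) \<in> parcs G" for i using u(2) set_p by auto
    show "(\<lambda>(u, v). {u, v}) ` set p = range (\<lambda>i. {c i, c (Suc i)})"
      unfolding set_p by (auto simp: image_iff)
  qed
qed

text \<open>If two edges with different indices coincide, each index is the successor of the other
  modulo g, so g divides 2. This makes the girth, defined by counting edges, the length of the
  walk.\<close>

lemma card_cycle_edges:
  assumes g: "3 \<le> g" and c: "\<And>i j. c i = c j \<longleftrightarrow> i mod g = j mod (g :: nat)"
  shows "card (range (\<lambda>i. {c i, c (Suc i)})) = g"
proof -
  let ?e = "\<lambda>i. {c i, c (Suc i)}"
  have "range ?e = ?e ` {..<g}"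
  proof -
    have "?e i = ?e (i mod g)" for i
    proof -
      have "c i = c (i mod g)" "c (Suc i) = c (Suc (i mod g))" by (simp_all add: c mod_Suc_eq)
      then show ?thesis by simp
    qed
    moreover have "i mod g \<in> {..<g}" for i using g by simp
    ultimately show ?thesis by blast
  qed
  moreover have "inj_on ?e {..<g}"
  proof (rule inj_onI)
    fix i j assume ij: "i \<in> {..<g}" "j \<in> {..<g}" and e: "?e i = ?e j"
    show "i = j"
    proof (rule ccontr)
      assume ne: "i \<noteq> j"
      then have "c i \<noteq> c j" using ij by (simp add: c)
      with e have "c i = c (Suc j)" "c j = c (Suc i)" by (auto simp: doubleton_eq_iff)
      then have mods: "i = Suc j mod g" "j = Suc i mod g" using ij by (simp_all add: c)
      have Suc_mod: "Suc k mod g = (if Suc k = g then 0 else Suc k)" if "k < g" for k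
        using that by simp
      have "i = (if Suc j = g then 0 else Suc j)" "j = (if Suc i = g then 0 else Suc i)"
        using mods Suc_mod[of i] Suc_mod[of j] ij by (metis lessThan_iff)+
      then show False using g by presburger
    qed
  qed
  ultimately show ?thesis by (simp add: card_image)
qed

section \<open>Attaching all remaining vertices to one cycle vertex\<close>

text \<open>The cycle is traversed periodically by \<open>c\<close>, so that indices need not be reduced modulo \<open>g\<close>;
  the predecessor of \<open>c k\<close> is \<open>c (k + g - 1)\<close>.\<close>

locale cycle_in_graph = pair_graph G for G :: "'a pair_pre_digraph" +
  fixes g :: nat and c :: "nat \<Rightarrow> 'a"
  assumes g_ge_3: "3 \<le> g"
    and c_eq_iff: "c i = c j \<longleftrightarrow> i mod g = j mod g"
    and c_arc: "(c i, c (Suc i)) \<in> parcs G"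
begin

definition cycle_arcs :: "'a rel" where
  "cycle_arcs = range (\<lambda>i. (c i, c (Suc i))) \<union> range (\<lambda>i. (c (Suc i), c i))"

definition off_cycle :: "'a set" where
  "off_cycle = pverts G - range c"

text \<open>The closed neighbourhood of \<open>c k\<close> on the cycle, which is also the set of
  cycle vertices that a pendant vertex at \<open>c k\<close> sees in the square.\<close>

definition nbhd :: "nat \<Rightarrow> 'a set" where
  "nbhd k = {c k, c (Suc k), c (k + g - 1)}"

text \<open>The vertex set of \<open>G\<close> is kept, so the forms of both squares can be
  evaluated at the same vector.\<close>

definition pendant :: "nat \<Rightarrow> 'a pair_pre_digraph" where
  "pendant k = \<lparr> pverts = pverts G,
     parcs = cycle_arcs \<union> off_cycle \<times> {c k} \<union> {c k} \<times> off_cycle \<rparr>"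

lemma pverts_pendant [simp]: "pverts (pendant k) = pverts G"
  by (simp add: pendant_def)

lemma parcs_pendant: "parcs (pendant k) = cycle_arcs \<union> off_cycle \<times> {c k} \<union> {c k} \<times> off_cycle"
  by (simp add: pendant_def)

section \<open>Index arithmetic and arcs on the cycle\<close>

lemma c_Suc_eq_iff: "c (Suc i) = c (Suc j) \<longleftrightarrow> c i = c j"
proof
  assume "c (Suc i) = c (Suc j)"
  then have "(Suc i + (g - 1)) mod g = (Suc j + (g - 1)) mod g"
    unfolding c_eq_iff by (rule mod_add_cong) simp
  moreover have "Suc l + (g - 1) = l + g" for l using g_ge_3 by simp
  ultimately show "c i = c j" by (simp add: c_eq_iff)
next
  assume "c i = c j"
  then show "c (Suc i) = c (Suc j)" by (metis c_eq_iff mod_Suc_eq)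
qed

lemma c_pred: "c (Suc (k + g - 1)) = c k"
  using g_ge_3 by (simp add: c_eq_iff)

lemma c_shift:
  obtains k where "k < g" "c (m + k) = c i"
proof
  \<comment> \<open>This is i - m modulo g, with m reduced first so that the subtraction stays
    within the naturals.\<close>
  let ?k = "(i + (g - m mod g)) mod g"
  show "?k < g" using g_ge_3 by simp
  have "m mod g < g" using g_ge_3 by simp
  then have "m + (i + (g - m mod g)) = i + g * Suc (m div g)"
    using mult_div_mod_eq[of g m] unfolding mult_Suc_right by linarith
  then have "(m + ?k) mod g = i mod g" by (metis mod_add_right_eq mod_mult_self2)
  then show "c (m + ?k) = c i" by (simp add: c_eq_iff)
qed

lemma c_Suc_neq: "c i \<noteq> c (Suc i)"
  using c_arc no_loops' by blast

lemma c_in_verts: "c i \<in> pverts G"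
  using c_arc wellformed'(1) by blast

lemma range_c: "range c = c ` {..<g}" "inj_on c {..<g}"
proof -
  show "inj_on c {..<g}" by (rule inj_onI) (simp add: c_eq_iff)
  show "range c = c ` {..<g}"
  proof (intro equalityI subsetI)
    fix x assume "x \<in> range c"
    then obtain i where "x = c i" by blast
    moreover obtain k where "k < g" "c (0 + k) = c i" by (rule c_shift)
    ultimately show "x \<in> c ` {..<g}" by (auto intro!: image_eqI[of _ _ k])
  qed auto
qed

lemma finite_range_c: "finite (range c)" and card_range_c: "card (range c) = g"
  using range_c by (simp_all add: card_image)

lemma verts_split: "pverts G = range c \<union> off_cycle" "range c \<inter> off_cycle = {}"
  using c_in_verts by (auto simp: off_cycle_def)

lemma finite_off_cycle: "finite off_cycle"
  by (simp add: off_cycle_def pair_finite_verts)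

lemma card_off_cycle: "card off_cycle = card (pverts G) - g"
  unfolding off_cycle_def card_range_c[symmetric]
  using c_in_verts by (intro card_Diff_subset) (auto intro: finite_range_c)

lemma cycle_arcs_sym: "(u, v) \<in> cycle_arcs \<Longrightarrow> (v, u) \<in> cycle_arcs"
  by (auto simp: cycle_arcs_def)

lemma cycle_arcs_range: "(u, v) \<in> cycle_arcs \<Longrightarrow> u \<in> range c \<and> v \<in> range c"
  by (auto simp: cycle_arcs_def)

lemma cycle_arcs_subset: "cycle_arcs \<subseteq> parcs G"
  using c_arc arcs_symmetric by (auto simp: cycle_arcs_def)

lemma cycle_arcs_iff: "(c k, v) \<in> cycle_arcs \<longleftrightarrow> v = c (Suc k) \<or> v = c (k + g - 1)"
proof
  assume "(c k, v) \<in> cycle_arcs"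
  then consider i where "c k = c i" "v = c (Suc i)" | i where "c k = c (Suc i)" "v = c i"
    by (auto simp: cycle_arcs_def)
  then show "v = c (Suc k) \<or> v = c (k + g - 1)"
  proof cases
    case 1
    then show ?thesis using c_Suc_eq_iff by metis
  next
    case 2
    then show ?thesis using c_Suc_eq_iff c_pred by metis
  qed
next
  have "(c k, c (Suc k)) \<in> cycle_arcs" "(c (Suc (k + g - 1)), c (k + g - 1)) \<in> cycle_arcs"
    unfolding cycle_arcs_def by blast+
  moreover assume "v = c (Suc k) \<or> v = c (k + g - 1)"
  ultimately show "(c k, v) \<in> cycle_arcs"
    unfolding c_pred by blast
qed

lemma nbhd_subset: "nbhd k \<subseteq> range c"
  by (auto simp: nbhd_def)

lemma nbhd_altdef: "nbhd k = insert (c k) {v. (c k, v) \<in> cycle_arcs}"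
  by (auto simp: nbhd_def cycle_arcs_iff)

lemma pair_graph_pendant: "pair_graph (pendant k)"
proof
  have off: "w \<in> pverts G" if "w \<in> off_cycle" for w using that by (simp add: off_cycle_def)
  have wf: "u \<in> pverts G \<and> v \<in> pverts G" if "(u, v) \<in> parcs (pendant k)" for u v
    using that cycle_arcs_subset off c_in_verts wellformed' unfolding parcs_pendant by blast
  then show "fst e \<in> pverts (pendant k)" "snd e \<in> pverts (pendant k)"
    if "e \<in> parcs (pendant k)" for e
    using that by (cases e; simp)+
  show "finite (pverts (pendant k))" by (simp add: pair_finite_verts)
  have "parcs (pendant k) \<subseteq> pverts G \<times> pverts G" using wf by auto
  then show "finite (parcs (pendant k))"
    by (rule finite_subset) (simp add: pair_finite_verts)
  show "fst e \<noteq> snd e" if "e \<in> parcs (pendant k)" for e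
    using that verts_split(2) cycle_arcs_subset no_loops'
    by (cases e) (auto simp: parcs_pendant)
  show "symmetric (with_proj (pendant k))"
    unfolding symmetric_def sym_def with_proj_simps parcs_pendant
    using cycle_arcs_sym by blast
qed

section \<open>The square of the pendant graph and its identification with the coalescence\<close>

lemma square_pendant_off_cycle:
  assumes "u \<in> off_cycle" "v \<in> off_cycle" "u \<noteq> v"
  shows "(u, v) \<in> square_rel (parcs (pendant k))"
  using assms by (auto simp: square_rel_def parcs_pendant)

lemma square_pendant_mixed:
  assumes "w \<in> off_cycle"
  shows "{v \<in> range c. (w, v) \<in> square_rel (parcs (pendant k))} = nbhd k"
proof -
  have w: "w \<notin> range c" using assms verts_split(2) by blast
  then have "(w, v) \<in> parcs (pendant k) \<longleftrightarrow> v = c k" for v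
    using assms cycle_arcs_range by (auto simp: parcs_pendant)
  moreover have "(c k, v) \<in> parcs (pendant k) \<longleftrightarrow> (c k, v) \<in> cycle_arcs" if "v \<in> range c" for v
    using that verts_split(2) by (auto simp: parcs_pendant)
  moreover have "w \<noteq> v" if "v \<in> range c" for v using that w by blast
  ultimately have "{v \<in> range c. (w, v) \<in> square_rel (parcs (pendant k))}
      = {v \<in> range c. v = c k \<or> (c k, v) \<in> cycle_arcs}"
    unfolding square_rel_def by auto
  also have "\<dots> = nbhd k"
    using nbhd_subset[of k] unfolding nbhd_altdef by auto
  finally show ?thesis .
qed

text \<open>The cycle has rotations, so \<open>v\<close> can be sent to any chosen
  \<open>c k\<close>; the leaves of the star go to the vertices off the cycle by an arbitrary
  bijection.\<close>

lemma coalescence_iso_pendant: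
  assumes v: "v < g" and n: "n = card (pverts G)"
  shows "digraph_iso (with_proj (coalescence (cycle_graph g) v (star_graph (n - g + 1)) 0))
    (with_proj (pendant k))"
proof -
  define H where "H = coalescence (cycle_graph g) v (star_graph (n - g + 1)) 0"
  obtain b where b: "bij_betw b {1..n - g} off_cycle"
    using finite_same_card_bij[of "{1..n - g}" off_cycle] finite_off_cycle card_off_cycle n
    by auto
  \<comment> \<open>The rotation offset: m + v = k + g, hence \<open>c (m + v)\<close> is
    \<open>c k\<close>.\<close>
  define m where "m = k + (g - v)"
  define f where "f = case_sum (\<lambda>i. c (m + i)) b"
  have verts: "pverts H = Inl ` {..<g} \<union> Inr ` {1..n - g}"
    using v by (auto simp: H_def coalescence_def cycle_graph_def star_graph_def Let_def image_iff)
  have cyc: "map_prod Inl Inl ` parcs (cycle_graph g) =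
      {(Inl i, Inl j) | i j. i < g \<and> j < g \<and> (j = Suc i mod g \<or> i = Suc j mod g)}"
    by (auto simp: cycle_graph_def)
  define h where "h x = (if x = 0 then Inl v else Inr x)" for x :: nat
  have star: "map_prod h h ` parcs (star_graph (n - g + 1)) =
      Inr ` {1..n - g} \<times> {Inl v} \<union> {Inl v} \<times> Inr ` {1..n - g}"
  proof (intro equalityI subsetI)
    fix e assume "e \<in> map_prod h h ` parcs (star_graph (n - g + 1))"
    then show "e \<in> Inr ` {1..n - g} \<times> {Inl v} \<union> {Inl v} \<times> Inr ` {1..n - g}"
      by (auto simp: star_graph_def h_def)
  next
    fix e :: "(nat + nat) \<times> (nat + nat)"
    assume "e \<in> Inr ` {1..n - g} \<times> {Inl v} \<union> {Inl v} \<times> Inr ` {1..n - g}"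
    then consider j where "j \<in> {1..n - g}" "e = map_prod h h (j, 0)"
      | j where "j \<in> {1..n - g}" "e = map_prod h h (0, j)"
      by (auto simp: h_def)
    then show "e \<in> map_prod h h ` parcs (star_graph (n - g + 1))"
      by cases (auto simp: star_graph_def intro!: imageI)
  qed
  have arcs: "parcs H = map_prod Inl Inl ` parcs (cycle_graph g) \<union>
      (Inr ` {1..n - g} \<times> {Inl v} \<union> {Inl v} \<times> Inr ` {1..n - g})"
    unfolding star[symmetric] by (simp add: H_def coalescence_def Let_def h_def[abs_def])
  have f_Inr: "f ` Inr ` {1..n - g} = off_cycle"
    using b by (simp add: f_def image_image bij_betw_def)
  have f_v: "f (Inl v) = c k"
    using v by (simp add: f_def m_def c_eq_iff)
  have f_Inl: "f ` Inl ` {..<g} = range c"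
  proof -
    have "c i \<in> (\<lambda>i. c (m + i)) ` {..<g}" for i
    proof -
      obtain j where "j < g" "c (m + j) = c i" by (rule c_shift)
      then show ?thesis by (auto intro!: image_eqI[of _ _ j])
    qed
    then show ?thesis by (auto simp: f_def image_image)
  qed
  have c_step: "c (m + Suc i mod g) = c (Suc (m + i))" for i
    by (simp add: c_eq_iff mod_add_right_eq)
  have f_cyc: "map_prod f f ` map_prod Inl Inl ` parcs (cycle_graph g) = cycle_arcs"
  proof (intro equalityI subsetI)
    fix e assume "e \<in> map_prod f f ` map_prod Inl Inl ` parcs (cycle_graph g)"
    then show "e \<in> cycle_arcs"
      unfolding cyc by (auto simp: f_def cycle_arcs_def c_step)
  next
    fix e assume "e \<in> cycle_arcs"
    then obtain i where i: "e = (c i, c (Suc i)) \<or> e = (c (Suc i), c i)"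
      by (auto simp: cycle_arcs_def)
    obtain j where j: "j < g" "c (m + j) = c i" by (rule c_shift)
    have j': "Suc j mod g < g" using j by simp
    have "c (Suc i) = c (m + Suc j mod g)" using j by (simp add: c_step c_Suc_eq_iff)
    with i j have "e = map_prod f f (Inl j, Inl (Suc j mod g)) \<or> e = map_prod f f (Inl (Suc j mod g), Inl j)"
      by (simp add: f_def)
    then show "e \<in> map_prod f f ` map_prod Inl Inl ` parcs (cycle_graph g)"
      unfolding cyc using j(1) j' by (auto intro!: imageI)
  qed
  show ?thesis
    unfolding H_def[symmetric]
  proof (rule digraph_iso_with_projI)
    show "pair_wf_digraph H"
      by unfold_locales (use v in \<open>auto simp: verts arcs cyc\<close>)
    show "pverts (pendant k) = f ` pverts H"
      unfolding verts image_Un f_Inl f_Inr by (simp add: verts_split(1))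
    show "parcs (pendant k) = map_prod f f ` parcs H"
      unfolding arcs parcs_pendant image_Un f_cyc map_prod_surj_on[OF refl refl] f_Inr
      by (simp add: f_v Un_assoc)
    show "inj_on f (pverts H)"
    proof -
      \<comment> \<open>By counting: the rotated indices still reach all g cycle vertices.\<close>
      have "inj_on (\<lambda>i. c (m + i)) {..<g}"
      proof (rule eq_card_imp_inj_on)
        show "card ((\<lambda>i. c (m + i)) ` {..<g}) = card {..<g}"
          using f_Inl card_range_c by (simp add: f_def image_image)
      qed simp
      then have "inj_on f (Inl ` {..<g})" by (simp add: inj_on_def f_def)
      moreover have "inj_on f (Inr ` {1..n - g})"
        using b by (simp add: inj_on_def f_def bij_betw_def)
      moreover have "f ` Inl ` {..<g} \<inter> f ` Inr ` {1..n - g} = {}"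
        unfolding f_Inl f_Inr by (rule verts_split(2))
      ultimately show ?thesis
        unfolding verts inj_on_Un by blast
    qed
  qed
qed

end

section \<open>Graphs with a unique cycle\<close>

text \<open>Uniqueness is recorded for vertex lists. Control of the closing edge alone suffices for
  chords, since a list can be arranged so that a given chord closes it.\<close>

locale unicyclic_graph = cycle_in_graph +
  assumes unique_cycle: "vertex_cycle (parcs G) ys \<Longrightarrow>
    set ys \<subseteq> range c \<and> {last ys, hd ys} \<in> range (\<lambda>i. {c i, c (Suc i)})"
begin

text \<open>At most g consecutive indices are pairwise incongruent modulo g, so the segment is a
  path; it is the raw material for second cycles.\<close>

lemma cycle_segment:
  assumes "k < g"
  shows "distinct (map c [j..<Suc (j + k)])"
    "successively (\<lambda>u v. (u, v) \<in> parcs G) (map c [j..<Suc (j + k)])"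
    "hd (map c [j..<Suc (j + k)]) = c j" "last (map c [j..<Suc (j + k)]) = c (j + k)"
proof -
  have "inj_on c {j..<Suc (j + k)}"
  proof (rule inj_onI)
    fix a b assume ab: "a \<in> {j..<Suc (j + k)}" "b \<in> {j..<Suc (j + k)}" and "c a = c b"
    then have "a mod g = b mod g" by (simp add: c_eq_iff)
    moreover have "a - b < g" "b - a < g" using ab assms by auto
    ultimately show "a = b"
      by (metis diff_is_0_eq le_antisym mod_eq_dvd_iff_nat nat_dvd_not_less nat_le_linear not_gr_zero)
  qed
  then show "distinct (map c [j..<Suc (j + k)])" by (simp add: distinct_map del: upt_Suc)
  show "successively (\<lambda>u v. (u, v) \<in> parcs G) (map c [j..<Suc (j + k)])"
    using c_arc by (auto simp: successively_conv_nth simp del: upt_Suc)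
  show "hd (map c [j..<Suc (j + k)]) = c j"
    by (subst hd_map) (auto simp del: upt_Suc)
  show "last (map c [j..<Suc (j + k)]) = c (j + k)" by simp
qed

text \<open>An ear closes up with a segment of the cycle to a second cycle; if its two ends coincide,
  it is itself a second cycle unless it has a single inner vertex.\<close>

lemma no_ear:
  assumes "a \<in> range c" "b \<in> range c" "zs \<noteq> []" "distinct zs" "set zs \<inter> range c = {}"
    "successively (\<lambda>u v. (u, v) \<in> parcs G) zs" "(a, hd zs) \<in> parcs G" "(last zs, b) \<in> parcs G"
  shows "length zs = 1 \<and> a = b"
proof (rule ccontr)
  assume long: "\<not> ?thesis"
  obtain i j where ij: "a = c i" "b = c j" using assms by auto
  obtain k where k: "k < g" "c (j + k) = c i" by (rule c_shift)
  let ?seg = "map c [j..<Suc (j + k)]"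
  note seg = cycle_segment[OF k(1), of j]
  have "3 \<le> length (?seg @ zs)"
  proof -
    have "length zs \<ge> 1" using assms(3) by (cases zs) auto
    \<comment> \<open>If k = 0 the two ends coincide, and the negated claim leaves at least two
      inner vertices.\<close>
    moreover have "k \<ge> 1 \<or> length zs \<ge> 2"
    proof (rule ccontr)
      assume "\<not> ?thesis"
      with calculation have "k = 0" "length zs = 1" by auto
      with k ij long show False by simp
    qed
    ultimately show ?thesis by auto
  qed
  moreover have "distinct (?seg @ zs)"
    unfolding distinct_append using seg(1) assms(4,5) by auto
  moreover have "successively (\<lambda>u v. (u, v) \<in> parcs G) (?seg @ zs)"
    unfolding successively_append_iff using seg(2,4) assms(6,7) ij k(2) by simp
  moreover have "(last (?seg @ zs), hd (?seg @ zs)) \<in> parcs G"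
    using seg(3) assms(3,8) ij by (simp add: hd_append del: upt_Suc)
  ultimately have "vertex_cycle (parcs G) (?seg @ zs)" unfolding vertex_cycle_def by blast
  from unique_cycle[OF this] have "set zs \<subseteq> range c" by auto
  with assms(3,5) show False by (cases zs) auto
qed

text \<open>The edge closes the cycle segment from \<open>b\<close> to \<open>a\<close>, so
  uniqueness makes it a cycle edge. A segment with a single step is too short for this, but then the
  edge is a cycle edge already.\<close>

lemma chordless:
  assumes "a \<in> range c" "b \<in> range c" "(a, b) \<in> parcs G"
  shows "(a, b) \<in> cycle_arcs"
proof -
  obtain i j where ij: "a = c i" "b = c j" using assms by auto
  obtain k where k: "k < g" "c (j + k) = c i" by (rule c_shift)
  note seg = cycle_segment[OF k(1), of j]
  have "k \<noteq> 0" using k ij assms(3) no_loops' by (metis add_0_right)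
  then consider "k = 1" | "2 \<le> k" by linarith
  then show ?thesis
  proof cases
    case 1
    then have "(a, b) = (c (Suc j), c j)" using k ij by simp
    then show ?thesis unfolding cycle_arcs_def by blast
  next
    case 2
    then have "vertex_cycle (parcs G) (map c [j..<Suc (j + k)])"
      unfolding vertex_cycle_def seg(3,4) using seg(1,2) assms(3) ij k(2) by auto
    from unique_cycle[OF this] have "{c i, c j} \<in> range (\<lambda>i. {c i, c (Suc i)})"
      unfolding seg(3,4) k(2) by blast
    then show ?thesis unfolding cycle_arcs_def ij by (auto simp: doubleton_eq_iff)
  qed
qed

section \<open>Short ears and adjacency in the square\<close>

lemma off_cycleD: "w \<in> off_cycle \<Longrightarrow> w \<notin> range c"
  by (simp add: off_cycle_def)

lemma arc_cases: "(u, v) \<in> parcs G \<Longrightarrow> v \<in> range c \<or> v \<in> off_cycle"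
  using wellformed' by (auto simp: off_cycle_def)

lemma no_ear1:
  assumes "a \<in> range c" "b \<in> range c" "z \<in> off_cycle" "(z, a) \<in> parcs G" "(z, b) \<in> parcs G"
  shows "a = b"
  using no_ear[of a b "[z]"] assms arcs_symmetric off_cycleD by auto

lemma no_ear2:
  assumes "a \<in> range c" "b \<in> range c" "z \<in> off_cycle" "w \<in> off_cycle"
    "(z, a) \<in> parcs G" "(z, w) \<in> parcs G" "(w, b) \<in> parcs G"
  shows False
  using no_ear[of a b "[z, w]"] assms arcs_symmetric off_cycleD no_loops'[of z w] by auto

lemma no_ear3:
  assumes "a \<in> range c" "b \<in> range c" "z \<in> off_cycle" "w \<in> off_cycle" "z' \<in> off_cycle" "z \<noteq> z'"
    "(z, a) \<in> parcs G" "(z, w) \<in> parcs G" "(w, z') \<in> parcs G" "(z', b) \<in> parcs G"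
  shows False
  using no_ear[of a b "[z, w, z']"] assms arcs_symmetric off_cycleD
    no_loops'[of z w] no_loops'[of w z'] by auto

text \<open>A midpoint off the cycle would be an ear with distinct ends. So the midpoint is on the
  cycle, and by \<open>chordless\<close> only cycle arcs occur; these are common to all the graphs
  \<open>pendant k\<close>.\<close>

lemma square_on_cycle:
  assumes "a \<in> range c" "b \<in> range c" "(a, b) \<in> square_rel (parcs G)"
  shows "(a, b) \<in> square_rel (parcs (pendant k))"
proof -
  from assms(3) have ne: "a \<noteq> b"
    and "(a, b) \<in> parcs G \<or> (\<exists>z. (a, z) \<in> parcs G \<and> (z, b) \<in> parcs G)"
    by (auto simp: square_rel_def)
  then consider "(a, b) \<in> parcs G" | z where "(a, z) \<in> parcs G" "(z, b) \<in> parcs G" by blast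
  then show ?thesis
  proof cases
    case 1
    then have "(a, b) \<in> cycle_arcs" using assms chordless by blast
    then show ?thesis using ne by (auto simp: square_rel_def parcs_pendant)
  next
    case 2
    have "z \<notin> off_cycle" using no_ear1[of a b z] 2 assms ne arcs_symmetric by blast
    then have "z \<in> range c" using arc_cases 2 by blast
    then have "(a, z) \<in> cycle_arcs" "(z, b) \<in> cycle_arcs" using 2 assms chordless by blast+
    then show ?thesis using ne by (auto simp: square_rel_def parcs_pendant)
  qed
qed

text \<open>The only cycle neighbour of \<open>w\<close> is \<open>c i\<close>. A two-step walk
  through a vertex off the cycle would give an ear with two inner vertices, so it must pass through
  \<open>c i\<close>.\<close>

lemma square_mixed_attached:
  assumes w: "w \<in> off_cycle" and i: "(w, c i) \<in> parcs G"
  shows "{v \<in> range c. (w, v) \<in> square_rel (parcs G)} \<subseteq> nbhd i"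
proof clarify
  fix j assume "(w, c j) \<in> square_rel (parcs G)"
  then consider "(w, c j) \<in> parcs G" | z where "(w, z) \<in> parcs G" "(z, c j) \<in> parcs G"
    by (auto simp: square_rel_def)
  then show "c j \<in> nbhd i"
  proof cases
    case 1
    then have "c j = c i" using no_ear1[OF _ _ w _ i] by blast
    then show ?thesis by (simp add: nbhd_def)
  next
    case 2
    have "z \<notin> off_cycle" using no_ear2[of "c i" "c j" w z] w i 2 by blast
    then have z: "z \<in> range c" using arc_cases 2 by blast
    then have "z = c i" using no_ear1[OF _ _ w _ i] 2 by blast
    then have "(c i, c j) \<in> cycle_arcs" using 2 chordless by blast
    then show ?thesis by (simp add: nbhd_altdef)
  qed
qed

text \<open>Midpoints of two-step walks from \<open>w\<close> to the cycle lie off the cycle. Two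
  different ones would form an ear with \<open>w\<close> between them, and one midpoint has only one
  cycle neighbour.\<close>

lemma square_mixed_detached:
  assumes w: "w \<in> off_cycle" and no: "\<And>i. (w, c i) \<notin> parcs G"
  obtains i where "{v \<in> range c. (w, v) \<in> square_rel (parcs G)} \<subseteq> {c i}"
proof -
  have *: "\<exists>z \<in> off_cycle. (w, z) \<in> parcs G \<and> (z, v) \<in> parcs G"
    if v: "v \<in> range c" "(w, v) \<in> square_rel (parcs G)" for v
  proof -
    obtain z where z: "(w, z) \<in> parcs G" "(z, v) \<in> parcs G"
      using v no by (auto simp: square_rel_def)
    then have "z \<in> off_cycle" using arc_cases no by blast
    then show ?thesis using z by blast
  qed
  have "v = v'" if v: "v \<in> range c" "(w, v) \<in> square_rel (parcs G)"
    and v': "v' \<in> range c" "(w, v') \<in> square_rel (parcs G)" for v v'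
  proof -
    obtain z where z: "z \<in> off_cycle" "(w, z) \<in> parcs G" "(z, v) \<in> parcs G" using *[OF v] by blast
    obtain z' where z': "z' \<in> off_cycle" "(w, z') \<in> parcs G" "(z', v') \<in> parcs G"
      using *[OF v'] by blast
    have "z = z'" using no_ear3[OF v(1) v'(1) z(1) w z'(1)] z z' arcs_symmetric by blast
    then show ?thesis using no_ear1 z z' v v' by blast
  qed
  then have "\<exists>i. {v \<in> range c. (w, v) \<in> square_rel (parcs G)} \<subseteq> {c i}" by blast
  then show thesis using that by blast
qed

text \<open>Two attached vertices are not adjacent, so being close in the square gives them a common
  neighbour. By \<open>no_ear3\<close> it is not off the cycle, hence it is the cycle neighbour of
  both.\<close>

lemma all_attached_imp_pendant:
  assumes attached: "\<And>w. w \<in> off_cycle \<Longrightarrow> \<exists>i. (w, c i) \<in> parcs G"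
    and close: "\<And>w w'. w \<in> off_cycle \<Longrightarrow> w' \<in> off_cycle \<Longrightarrow> w \<noteq> w' \<Longrightarrow> (w, w') \<in> square_rel (parcs G)"
  obtains k where "G = pendant k"
proof -
  obtain k where k: "\<And>w. w \<in> off_cycle \<Longrightarrow> (w, c k) \<in> parcs G"
  proof (cases "off_cycle = {}")
    \<comment> \<open>Here \<open>G\<close> is the cycle itself, and any index serves as
      \<open>k\<close>.\<close>
    case True
    then show thesis using that by blast
  next
    case False
    then obtain w0 k where w0: "w0 \<in> off_cycle" "(w0, c k) \<in> parcs G" using attached by blast
    have "(w, c k) \<in> parcs G" if w: "w \<in> off_cycle" for w
    proof (cases "w = w0")
      case False
      obtain i where i: "(w, c i) \<in> parcs G" using attached[OF w] by blast
      have "(w, w0) \<notin> parcs G" using no_ear2[of "c i" "c k" w w0] w w0 i by blast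
      then obtain z where z: "(w, z) \<in> parcs G" "(z, w0) \<in> parcs G"
        using close[OF w w0(1) False] by (auto simp: square_rel_def)
      have "z \<notin> off_cycle" using no_ear3[of "c i" "c k" w z w0] w w0 i z False by blast
      then have "z \<in> range c" using arc_cases z by blast
      moreover have "(w0, z) \<in> parcs G" using z arcs_symmetric by blast
      ultimately have "z = c k" using no_ear1 w0 by blast
      then show ?thesis using z by simp
    qed (use w0 in simp)
    then show thesis by (rule that)
  qed
  have "parcs G = parcs (pendant k)"
  proof (intro equalityI subrelI)
    fix u v assume uv: "(u, v) \<in> parcs G"
    then have vu: "(v, u) \<in> parcs G" by (rule arcs_symmetric)
    have "u \<in> range c \<or> u \<in> off_cycle" "v \<in> range c \<or> v \<in> off_cycle"
      using arc_cases uv vu by blast+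
    then consider "u \<in> range c" "v \<in> range c" | "u \<in> range c" "v \<in> off_cycle"
      | "u \<in> off_cycle" "v \<in> range c" | "u \<in> off_cycle" "v \<in> off_cycle" by blast
    then show "(u, v) \<in> parcs (pendant k)"
    proof cases
      case 1
      then show ?thesis using uv chordless by (auto simp: parcs_pendant)
    next
      case 2
      then have "u = c k" using no_ear1[of u "c k" v] k vu by blast
      then show ?thesis using 2 by (auto simp: parcs_pendant)
    next
      case 3
      then have "v = c k" using no_ear1[of v "c k" u] k uv by blast
      then show ?thesis using 3 by (auto simp: parcs_pendant)
    next
      case 4
      then show ?thesis using no_ear2[of "c k" "c k" u v] k uv by blast
    qed
  next
    fix u v assume "(u, v) \<in> parcs (pendant k)"
    then show "(u, v) \<in> parcs G"
      using k arcs_symmetric cycle_arcs_subset by (auto simp: parcs_pendant)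
  qed
  then have "G = pendant k" by (intro pair_pre_digraph.equality) simp_all
  then show thesis by (rule that)
qed

text \<open>The Perron vector \<open>x\<close> of the square of \<open>G\<close> attains the
  spectral radius there and is a test vector for the square of \<open>pendant k\<close>. The forms
  are compared on three blocks: on the cycle, off the cycle, and mixed.\<close>

lemma square_spectral_radius_le_pendant:
  assumes conn: "Digraph_Component.connected (with_proj G)"
  obtains k where
    "graph_spectral_radius (graph_square G) \<le> graph_spectral_radius (graph_square (pendant k))"
    "graph_spectral_radius (graph_square G) = graph_spectral_radius (graph_square (pendant k)) \<Longrightarrow>
       \<exists>k'. G = pendant k'"
proof -
  let ?V = "pverts G" and ?R = "square_rel (parcs G)"
  let ?\<rho> = "graph_spectral_radius (graph_square G)"
  have G: "pair_graph G" ..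
  have sym: "sym (parcs G)" using arcs_symmetric by (auto simp: sym_def)
  have ne: "?V \<noteq> {}" using c_in_verts by blast
  obtain x where x0: "\<And>v. 0 \<le> x v" "\<exists>v\<in>?V. x v \<noteq> 0"
    and x_eig: "\<And>u. u \<in> ?V \<Longrightarrow> (\<Sum>v\<in>{v \<in> ?V. (u, v) \<in> ?R}. x v) = ?\<rho> * x u"
    by (rule graph_square_perron[OF G ne]) blast
  have x_pos: "0 < x u" if u: "u \<in> ?V" for u
  proof (rule ccontr)
    assume "\<not> 0 < x u"
    then have xu: "x u = 0" using x0(1)[of u] by simp
    \<comment> \<open>At a zero of \<open>x\<close> the eigenvalue equation says that nonnegative
      values sum to zero. Zeros therefore spread along arcs, and by connectedness to all
      vertices.\<close>
    have zero_step: "x v = 0" if "x a = 0" "(a, v) \<in> parcs G" for a v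
    proof -
      have a: "a \<in> ?V" "v \<in> ?V" "a \<noteq> v" using that wellformed' no_loops' by blast+
      have "(\<Sum>v\<in>{v \<in> ?V. (a, v) \<in> ?R}. x v) = 0" using x_eig[OF a(1)] that(1) by simp
      then have "\<forall>v\<in>{v \<in> ?V. (a, v) \<in> ?R}. x v = 0"
        using x0(1) pair_finite_verts by (subst (asm) sum_nonneg_eq_0_iff) auto
      then show ?thesis using a that(2) by (auto simp: square_rel_def)
    qed
    obtain w where w: "w \<in> ?V" "x w \<noteq> 0" using x0(2) by blast
    have "strongly_connected (with_proj G)"
      using symmetric_connected_imp_strongly_connected[OF pair_sym_arcs conn] .
    then have "u \<rightarrow>\<^sup>*\<^bsub>with_proj G\<^esub> w" using u w(1) by (auto simp: strongly_connected_def)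
    then have "x w = 0"
      unfolding reachable_def
      by (induction rule: rtrancl_on_induct) (use xu zero_step in auto)
    with w(2) show False by simp
  qed
  define s where "s i = (\<Sum>v\<in>nbhd i. x v)" for i
  \<comment> \<open>The indices are unbounded, but every \<open>nbhd i\<close> is a subset of the
    finite cycle, so a maximising index exists.\<close>
  have "finite (range s)"
    by (rule finite_subset[of _ "sum x ` Pow (range c)"])
       (use finite_range_c nbhd_subset in \<open>auto simp: s_def\<close>)
  then obtain k where k: "\<And>i. s i \<le> s k"
    using Max_in[of "range s"] Max_ge[of "range s"] by (metis UNIV_not_empty image_is_empty imageE rangeI)
  let ?T = "square_rel (parcs (pendant k))"
  let ?\<rho>' = "graph_spectral_radius (graph_square (pendant k))"
  note T = pair_graph_pendant[of k]
  interpret T: pair_graph "pendant k" by (rule T)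
  have symT: "sym (parcs (pendant k))" using T.arcs_symmetric by (auto simp: sym_def)
  have "pverts (pendant k) \<noteq> {}" using ne by simp
  then have bound: "quad_form ?V ?T x \<le> ?\<rho>' * (\<Sum>v\<in>?V. (x v)\<^sup>2)"
    by (rule graph_square_perron[OF T]) simp
  have attained: "quad_form ?V ?R x = ?\<rho> * (\<Sum>v\<in>?V. (x v)\<^sup>2)"
  proof -
    have "quad_form ?V ?R x = (\<Sum>u\<in>?V. x u * (?\<rho> * x u))"
      unfolding quad_form_altdef[OF pair_finite_verts] by (intro sum.cong refl) (simp add: x_eig)
    then show ?thesis by (simp add: sum_distrib_left power2_eq_square algebra_simps)
  qed
  have N: "0 < (\<Sum>v\<in>?V. (x v)\<^sup>2)"
    using ne pair_finite_verts x_pos by (intro sum_pos) (auto simp: less_imp_neq[symmetric])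
  define nR where "nR w = (\<Sum>v\<in>{v \<in> range c. (w, v) \<in> ?R}. x v)" for w
  have split: "quad_form ?V Q x = quad_form (range c) Q x + quad_form off_cycle Q x
      + 2 * (\<Sum>u\<in>off_cycle. x u * (\<Sum>v\<in>{v \<in> range c. (u, v) \<in> Q}. x v))" if "sym Q" for Q
    unfolding verts_split(1)
    by (rule quad_form_Un_disjoint[OF finite_range_c finite_off_cycle verts_split(2) that])
  have quadR: "quad_form ?V ?R x = quad_form (range c) ?R x + quad_form off_cycle ?R x
      + 2 * (\<Sum>w\<in>off_cycle. x w * nR w)"
    using split[OF sym_square_rel[OF sym]] by (simp add: nR_def)
  have quadT: "quad_form ?V ?T x = quad_form (range c) ?T x + quad_form off_cycle ?T x
      + 2 * (\<Sum>w\<in>off_cycle. x w * s k)"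
    using split[OF sym_square_rel[OF symT]] by (simp add: square_pendant_mixed s_def)
  have nR_detached: "nR w < s k" if w: "w \<in> off_cycle" "\<And>i. (w, c i) \<notin> parcs G" for w
  proof -
    obtain i where "{v \<in> range c. (w, v) \<in> ?R} \<subseteq> {c i}" using square_mixed_detached w by blast
    then have "nR w \<le> sum x {c i}"
      unfolding nR_def using x0(1) by (intro sum_mono2) auto
    \<comment> \<open>Strictness comes from a cycle neighbour of \<open>c i\<close>, which has
      positive weight and is not counted by \<open>nR w\<close>.\<close>
    also have "\<dots> < sum x {c i, c (Suc i)}"
      using c_Suc_neq[of i] x_pos[OF c_in_verts] by simp
    also have "\<dots> \<le> s i"
      unfolding s_def nbhd_def using x0(1) by (intro sum_mono2) auto
    also have "\<dots> \<le> s k" by (rule k)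
    finally show ?thesis .
  qed
  have nR_le: "nR w \<le> s k" if w: "w \<in> off_cycle" for w
  proof (cases "\<exists>i. (w, c i) \<in> parcs G")
    case True
    then obtain i where i: "(w, c i) \<in> parcs G" by blast
    have "nR w \<le> s i"
      unfolding nR_def s_def using x0(1) square_mixed_attached[OF w i]
      by (intro sum_mono2) (auto simp: nbhd_def)
    then show ?thesis using k[of i] by simp
  next
    case False
    then show ?thesis using nR_detached[OF w] by auto
  qed
  have le1: "quad_form (range c) ?R x \<le> quad_form (range c) ?T x"
    using x0(1) square_on_cycle by (intro quad_form_mono) auto
  have sub: "(u, v) \<in> ?T" if "u \<in> off_cycle" "v \<in> off_cycle" "(u, v) \<in> ?R" for u v
    using that square_pendant_off_cycle by (auto simp: square_rel_def)
  have le2: "quad_form off_cycle ?R x \<le> quad_form off_cycle ?T x"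
    using x0(1) sub by (intro quad_form_mono) auto
  have le3: "(\<Sum>w\<in>off_cycle. x w * nR w) \<le> (\<Sum>w\<in>off_cycle. x w * s k)"
    using x0(1) nR_le by (intro sum_mono mult_left_mono) auto
  have "?\<rho> * (\<Sum>v\<in>?V. (x v)\<^sup>2) \<le> ?\<rho>' * (\<Sum>v\<in>?V. (x v)\<^sup>2)"
    using attained bound le1 le2 le3 quadR quadT by linarith
  then have le: "?\<rho> \<le> ?\<rho>'" using N by simp
  have "\<exists>k'. G = pendant k'" if eq: "?\<rho> = ?\<rho>'"
  proof -
    \<comment> \<open>Equal radii leave no slack in the total, so no single block can gain
      strictly.\<close>
    have "quad_form ?V ?T x \<le> quad_form ?V ?R x" using attained bound eq by simp
    then have eq2: "\<not> quad_form off_cycle ?R x < quad_form off_cycle ?T x"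
      and eq3: "\<not> (\<Sum>w\<in>off_cycle. x w * nR w) < (\<Sum>w\<in>off_cycle. x w * s k)"
      using le1 le2 le3 quadR quadT by linarith+
    have off_pos: "0 < x w" if "w \<in> off_cycle" for w using that x_pos verts_split(1) by blast
    have close: "(w, w') \<in> ?R" if "w \<in> off_cycle" "w' \<in> off_cycle" "w \<noteq> w'" for w w'
    proof (rule ccontr)
      assume "(w, w') \<notin> ?R"
      then have "quad_form off_cycle ?R x < quad_form off_cycle ?T x"
        by (intro quad_form_strict_mono[OF finite_off_cycle, of _ _ _ w w'])
           (simp_all add: off_pos sub that square_pendant_off_cycle)
      with eq2 show False ..
    qed
    have attached: "\<exists>i. (w, c i) \<in> parcs G" if w: "w \<in> off_cycle" for w
    proof (rule ccontr)
      assume "\<nexists>i. (w, c i) \<in> parcs G"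
      then have "nR w < s k" using nR_detached[OF w] by blast
      then have "x w * nR w < x w * s k" using off_pos[OF w] by simp
      moreover have "x w' * nR w' \<le> x w' * s k" if "w' \<in> off_cycle" for w'
        using nR_le[OF that] x0(1) by (intro mult_left_mono) auto
      ultimately have "(\<Sum>w\<in>off_cycle. x w * nR w) < (\<Sum>w\<in>off_cycle. x w * s k)"
        using w finite_off_cycle by (intro sum_strict_mono_ex1) auto
      with eq3 show False ..
    qed
    obtain k' where "G = pendant k'" using all_attached_imp_pendant[OF attached close] by blast
    then show ?thesis ..
  qed
  with le show thesis by (rule that)
qed

end

text \<open>The unique cycle is parametrized periodically. The edge set of any vertex cycle must
  then equal the edge set of this one, which yields the locale assumption.\<close>

lemma unicyclic_imp_unicyclic_graph:
  assumes "unicyclic G"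
  obtains c where "unicyclic_graph G (unicyclic_girth G) c"
proof -
  interpret pair_graph G using assms by (simp add: unicyclic_def)
  obtain C where C: "C \<in> cycle_edge_sets G" and uniq: "\<And>S. S \<in> cycle_edge_sets G \<Longrightarrow> S = C"
    using assms unfolding unicyclic_def by blast
  then obtain p where p: "cycle p" "3 \<le> length p" "C = (\<lambda>(u, v). {u, v}) ` set p"
    unfolding cycle_edge_sets_def by blast
  obtain c where c: "\<And>i j. c i = c j \<longleftrightarrow> i mod length p = j mod length p"
    "\<And>i. (c i, c (Suc i)) \<in> parcs G" "C = range (\<lambda>i. {c i, c (Suc i)})"
    unfolding p(3) by (rule cycle_parametrization[OF pair_wf_digraph p(1,2)]) blast
  have "unicyclic_girth G = card C"
    unfolding unicyclic_girth_def using C uniq by (metis theI)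
  also have "\<dots> = length p" unfolding c(3) using p(2) c(1) by (rule card_cycle_edges)
  finally have girth: "unicyclic_girth G = length p" .
  have "unicyclic_graph G (unicyclic_girth G) c"
  proof unfold_locales
    fix ys assume "vertex_cycle (parcs G) ys"
    then obtain S where S: "S \<in> cycle_edge_sets G" "set ys \<subseteq> \<Union>S" "{last ys, hd ys} \<in> S"
      by (rule vertex_cycle_imp_cycle_edge_set[OF pair_wf_digraph])
    then have "S = range (\<lambda>i. {c i, c (Suc i)})" using uniq c(3) by blast
    with S show "set ys \<subseteq> range c \<and> {last ys, hd ys} \<in> range (\<lambda>i. {c i, c (Suc i)})" by auto
  qed (use p(2) c(1,2) girth in simp_all)
  then show thesis by (rule that)
qed

theorem theorem5p1:
  fixes n g v :: nat
    and U :: "'a pair_pre_digraph"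
    and U_tilde :: "(nat + nat) pair_pre_digraph"
  assumes "3 \<le> g" and "g \<le> n"
    and "v \<in> pverts (cycle_graph g)"
    and "U_tilde = coalescence (cycle_graph g) v (star_graph (n - g + 1)) 0"
    and "unicyclic U" and "card (pverts U) = n" and "unicyclic_girth U = g"
  shows "graph_spectral_radius (graph_square U) \<le> graph_spectral_radius (graph_square U_tilde)
    \<and> (graph_spectral_radius (graph_square U) = graph_spectral_radius (graph_square U_tilde)
        \<longleftrightarrow> digraph_iso (with_proj U) (with_proj U_tilde))"
proof -
  obtain c where "unicyclic_graph U g c"
    using unicyclic_imp_unicyclic_graph[OF assms(5)] assms(7) by blast
  then interpret unicyclic_graph U g c .
  have conn: "Digraph_Component.connected (with_proj U)" using assms(5) by (simp add: unicyclic_def)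
  have v: "v < g" using assms(3) by (simp add: cycle_graph_def)
  \<comment> \<open>This holds for every index, so the maximising \<open>k\<close> of the inequality
    and the possibly different \<open>k'\<close> of the equality case lead to the same
    \<open>U_tilde\<close>.\<close>
  have iso: "digraph_iso (with_proj (pendant k)) (with_proj U_tilde)" for k
  proof -
    have "digraph_iso (with_proj U_tilde) (with_proj (pendant k))"
      using coalescence_iso_pendant[OF v, of n k] assms(4,6) by simp
    \<comment> \<open>Well-formedness of \<open>U_tilde\<close> is part of being the source of an
      isomorphism; it is needed to reverse the direction.\<close>
    moreover from this have "wf_digraph (with_proj U_tilde)"
      unfolding digraph_iso_def pre_digraph.digraph_isomorphism_def by blast
    ultimately show ?thesis by (rule digraph_iso_swap[rotated])
  qed
  have radius: "graph_spectral_radius (graph_square (pendant k)) =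
      graph_spectral_radius (graph_square U_tilde)" for k
    by (rule digraph_iso_square_spectral_radius_eq[OF pair_graph_pendant iso])
  obtain k where
    "graph_spectral_radius (graph_square U) \<le> graph_spectral_radius (graph_square (pendant k))"
    "graph_spectral_radius (graph_square U) = graph_spectral_radius (graph_square (pendant k)) \<Longrightarrow>
       \<exists>k'. U = pendant k'"
    by (rule square_spectral_radius_le_pendant[OF conn]) blast
  moreover have "digraph_iso (with_proj U) (with_proj U_tilde)" if "U = pendant k'" for k'
    using iso[of k'] that by simp
  moreover have "graph_spectral_radius (graph_square U) = graph_spectral_radius (graph_square U_tilde)"
    if "digraph_iso (with_proj U) (with_proj U_tilde)"
    by (rule digraph_iso_square_spectral_radius_eq[OF pair_graph_axioms that])
  ultimately show ?thesis unfolding radius by blast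
qed

end
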